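(* Let $N\ge3$, and let the initial configuration $\Theta_0=(\theta_1^0,\dots,\theta_N^0)$ and the natural frequencies $\Omega_1,\dots,\Omega_N\in\mathbb{R}$ satisfy $$\frac1N\sum_{j=1}^N\Omega_j=0,\quad \frac1N\sum_{j=1}^N\theta_j^0=0,\quad \theta_j^0\in[-\pi,\pi)\ (1\le j\le N),$$ $$r_0:=\Big|\frac1N\sum_{j=1}^Ne^{\mathrm{i}\theta_j^0}\Big|>0,\quad \theta_j^0\neq\theta_k^0\ (1\le j\neq k\le N),\quad \|\Omega\|_\infty=\max_{1\le j\le N}|\Omega_j|<\infty .$$ Then there exist a large coupling strength $K_\infty>0$ and a small mesh size $h_0>0$ such that, if $K>K_\infty$ and $0<h<h_0$, a phase-locked state emerges asymptotically. More precisely, one can find a phase-locked state $\Theta^\infty$ such that the solution $\Theta^h(n)=(\theta_1^h(n),\dots,\theta_N^h(n))$ of $$\theta_i^h(n+1)=\theta_i^h(n)+h\Omega_i+\frac{hK}{N}\sum_{j=1}^N\sin\big(\theta_j^h(n)-\theta_i^h(n)\big),\quad n=0,1,\dots,\ 1\le i\le N,\qquad \Theta^h(0)=\Theta_0,$$ satisfies $$\lim_{n\to\infty}\|\Theta^h(n)-\Theta^\infty\|_\infty=0,$$ provided that $K>K_\infty$ and $0<h<h_0$.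
   Context: $\|\cdot\|_\infty$ is the $\ell^\infty$ norm on $\mathbb{R}^N$. $K$ is the coupling strength and $h$ the time-step (mesh size). A phase-locked state is here a constant configuration $\Theta^\infty=(\theta_1^\infty,\dots,\theta_N^\infty)$ that is an equilibrium of the system, i.e. $\Omega_i+\frac{K}{N}\sum_{j=1}^N\sin(\theta_j^\infty-\theta_i^\infty)=0$ for all $i$.
   Formalization: The mesh size h_0 is allowed to depend on the coupling strength K (for each K>K_∞ there is an h_0>0); with h_0 chosen independently of K the claim is false, since for large hK every phase-locked state can become unstable. *)

theory Defs
  imports "HOL-Analysis.Analysis"
begin

text \<open>The oscillators are indexed by a finite type \<open>'n\<close>, so \<open>N = CARD('n)\<close>. Phases are real
  numbers: they are not reduced modulo \<open>2 * pi\<close>.\<close>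

definition order_parameter :: "real ^ 'n \<Rightarrow> real" where
  "order_parameter \<theta> = cmod (1 / of_nat CARD('n) * (\<Sum>j\<in>UNIV. exp (\<i> * of_real (\<theta> $ j))))"

definition phase_locked_state :: "real \<Rightarrow> real ^ 'n \<Rightarrow> real ^ 'n \<Rightarrow> bool" where
  "phase_locked_state K \<Omega> \<theta> \<longleftrightarrow>
     (\<forall>i. \<Omega> $ i + K / real CARD('n) * (\<Sum>j\<in>UNIV. sin (\<theta> $ j - \<theta> $ i)) = 0)"

primrec discrete_kuramoto ::
    "real \<Rightarrow> real \<Rightarrow> real ^ 'n \<Rightarrow> real ^ 'n \<Rightarrow> nat \<Rightarrow> real ^ 'n" where
  "discrete_kuramoto h K \<Omega> \<theta>0 0 = \<theta>0"
| "discrete_kuramoto h K \<Omega> \<theta>0 (Suc n) =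
     (let \<theta> = discrete_kuramoto h K \<Omega> \<theta>0 n
      in \<chi> i. \<theta> $ i + h * \<Omega> $ i
               + h * K / real CARD('n) * (\<Sum>j\<in>UNIV. sin (\<theta> $ j - \<theta> $ i)))"

end

theory Submission
  imports Defs
begin

text \<open>
  After the substitution \<open>\<eta> = h * K\<close>, \<open>\<omega> = \<Omega> / K\<close> the scheme is a small perturbation of the
  gradient flow of identical oscillators: \<open>\<theta>\<^sub>i\<close> moves by \<open>\<eta> * (\<omega>\<^sub>i + S\<^sub>i)\<close>, where
  \<open>S\<^sub>i = mean_sin \<theta> i\<close>. Write \<open>C\<^sub>i = mean_cos \<theta> i\<close>. The proof works with cosines of phase
  differences throughout, so phases never have to be reduced modulo \<open>2 * pi\<close>.

  Formation of a cluster (\<open>eventually_clustered\<close>). Along the unperturbed flow the squared order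
  parameter grows at a rate given by the sum of the \<open>S\<^sub>i\<^sup>2\<close>. As it is bounded by 1, there must be
  long periods in which all \<open>S\<^sub>i\<close> are small, that is, in which every oscillator is nearly aligned or
  nearly antipodal to the mean field. Two antipodal oscillators repel each other, since
  \<open>1 - cos (\<theta>\<^sub>i - \<theta>\<^sub>j)\<close> has logarithmic growth rate \<open>- (C\<^sub>i + C\<^sub>j)\<close>; starting from distinct
  positions they cannot both remain antipodal for long. So at some time all oscillators but at most
  one lie in a small arc. The time needed is bounded in terms of the initial data alone, which makes
  the argument stable under the errors coming from frequencies and step size.

  Trapping (\<open>slow_orbit_clustered_stays\<close>). The cluster contains a majority, because \<open>N \<ge> 3\<close>,
  and hence holds together for ever. The cosine \<open>c\<close> of the angle from the remaining oscillator to the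
  cluster follows approximately \<open>c' = 1 - c\<^sup>2\<close>. So this oscillator either joins the cluster or stays near
  the antipode for all times.

  Convergence (\<open>clustered_orbit_locks\<close>). The velocities \<open>\<theta> (n + 1) - \<theta> n\<close> obey a linear consensus
  iteration and sum to zero. If all oscillators are clustered, velocity differences contract. If one
  oscillator stays antipodal, its own velocity is the single expanding direction of a saddle; an
  orbit with a sizeable component in that direction would have unbounded velocity
  (\<open>cone_dichotomy\<close>), so the velocities again decay exponentially. Hence the phases converge, and
  the limit is an equilibrium.
\<close>

section \<open>The mean field\<close>

definition mean_sin :: "real ^ 'n \<Rightarrow> 'n \<Rightarrow> real" where
  "mean_sin \<theta> i = (\<Sum>j\<in>UNIV. sin (\<theta> $ j - \<theta> $ i)) / real CARD('n)"

definition mean_cos :: "real ^ 'n \<Rightarrow> 'n \<Rightarrow> real" where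
  "mean_cos \<theta> i = (\<Sum>j\<in>UNIV. cos (\<theta> $ j - \<theta> $ i)) / real CARD('n)"

text \<open>The complex order parameter \<open>X + \<i> Y\<close> determines the coupling felt by every oscillator:
  \<open>mean_cos \<theta> i\<close> and \<open>mean_sin \<theta> i\<close> are the real and imaginary part of
  \<open>(X + \<i> Y) * exp (- \<i> * \<theta>\<^sub>i)\<close>. The identities below are algebra in these coordinates.\<close>

lemma mean_field_coordinates:
  fixes \<theta> :: "real ^ 'n"
  obtains X Y where
    "\<And>i. mean_cos \<theta> i = X * cos (\<theta> $ i) + Y * sin (\<theta> $ i)"
    "\<And>i. mean_sin \<theta> i = Y * cos (\<theta> $ i) - X * sin (\<theta> $ i)"
    "(order_parameter \<theta>)\<^sup>2 = X\<^sup>2 + Y\<^sup>2"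
    "(\<Sum>i\<in>UNIV. cos (\<theta> $ i)) = real CARD('n) * X"
    "(\<Sum>i\<in>UNIV. sin (\<theta> $ i)) = real CARD('n) * Y"
proof
  let ?X = "(\<Sum>i\<in>UNIV. cos (\<theta> $ i)) / real CARD('n)"
  let ?Y = "(\<Sum>i\<in>UNIV. sin (\<theta> $ i)) / real CARD('n)"
  show "mean_cos \<theta> i = ?X * cos (\<theta> $ i) + ?Y * sin (\<theta> $ i)" for i
    by (simp add: mean_cos_def cos_diff sum.distrib sum_distrib_right add_divide_distrib)
  show "mean_sin \<theta> i = ?Y * cos (\<theta> $ i) - ?X * sin (\<theta> $ i)" for i
    by (simp add: mean_sin_def sin_diff sum_subtractf sum_distrib_right diff_divide_distrib)
  have "1 / of_nat CARD('n) * (\<Sum>j\<in>UNIV. exp (\<i> * of_real (\<theta> $ j))) = Complex ?X ?Y"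
    by (simp add: complex_eq_iff Re_divide_of_nat Im_divide_of_nat
        flip: cis_conv_exp)
  then show "(order_parameter \<theta>)\<^sup>2 = ?X\<^sup>2 + ?Y\<^sup>2"
    by (simp add: order_parameter_def complex_norm)
qed simp_all

text \<open>Both sides are the squared modulus of the order parameter. If the \<open>mean_sin\<close> are small, each
  \<open>mean_cos\<close> is therefore close to plus or minus the order parameter: every oscillator is nearly
  aligned or nearly antipodal to the mean field, and the sign tells which.\<close>

lemma mean_cos_sin_squares: "(mean_cos \<theta> i)\<^sup>2 + (mean_sin \<theta> i)\<^sup>2 = (order_parameter \<theta>)\<^sup>2"
proof -
  obtain X Y where *:
    "\<And>i. mean_cos \<theta> i = X * cos (\<theta> $ i) + Y * sin (\<theta> $ i)"
    "\<And>i. mean_sin \<theta> i = Y * cos (\<theta> $ i) - X * sin (\<theta> $ i)"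
    "(order_parameter \<theta>)\<^sup>2 = X\<^sup>2 + Y\<^sup>2"
    using mean_field_coordinates by metis
  show ?thesis unfolding * using sin_cos_squared_add[of "\<theta> $ i"] by algebra
qed

lemma mean_cos_sin_inner:
  "mean_cos \<theta> i * mean_cos \<theta> j + mean_sin \<theta> i * mean_sin \<theta> j
    = (order_parameter \<theta>)\<^sup>2 * cos (\<theta> $ i - \<theta> $ j)"
proof -
  obtain X Y where *:
    "\<And>i. mean_cos \<theta> i = X * cos (\<theta> $ i) + Y * sin (\<theta> $ i)"
    "\<And>i. mean_sin \<theta> i = Y * cos (\<theta> $ i) - X * sin (\<theta> $ i)"
    "(order_parameter \<theta>)\<^sup>2 = X\<^sup>2 + Y\<^sup>2"
    using mean_field_coordinates by metis
  show ?thesis unfolding * cos_diff by algebra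
qed

text \<open>For identical oscillators the left-hand side is the rate of change of
  \<open>1 - cos (\<theta>\<^sub>i - \<theta>\<^sub>j)\<close>, so this identity says that the separation of a pair changes at
  logarithmic rate \<open>- (mean_cos \<theta> i + mean_cos \<theta> j)\<close>: pairs on the aligned side attract, pairs
  on the antipodal side repel.\<close>

lemma sin_times_mean_sin_diff:
  "sin (\<theta> $ i - \<theta> $ j) * (mean_sin \<theta> i - mean_sin \<theta> j)
    = - (1 - cos (\<theta> $ i - \<theta> $ j)) * (mean_cos \<theta> i + mean_cos \<theta> j)"
proof -
  obtain X Y where *:
    "\<And>i. mean_cos \<theta> i = X * cos (\<theta> $ i) + Y * sin (\<theta> $ i)"
    "\<And>i. mean_sin \<theta> i = Y * cos (\<theta> $ i) - X * sin (\<theta> $ i)"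
    using mean_field_coordinates by metis
  show ?thesis unfolding * cos_diff sin_diff
    using sin_cos_squared_add[of "\<theta> $ i"] sin_cos_squared_add[of "\<theta> $ j"] by algebra
qed

lemma sum_mean_cos:
  fixes \<theta> :: "real ^ 'n"
  shows "(\<Sum>i\<in>UNIV. mean_cos \<theta> i) = real CARD('n) * (order_parameter \<theta>)\<^sup>2"
proof -
  obtain X Y where *:
    "\<And>i. mean_cos \<theta> i = X * cos (\<theta> $ i) + Y * sin (\<theta> $ i)"
    "(order_parameter \<theta>)\<^sup>2 = X\<^sup>2 + Y\<^sup>2"
    "(\<Sum>i\<in>UNIV. cos (\<theta> $ i)) = real CARD('n) * X"
    "(\<Sum>i\<in>UNIV. sin (\<theta> $ i)) = real CARD('n) * Y"
    using mean_field_coordinates by metis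
  have "(\<Sum>i\<in>UNIV. mean_cos \<theta> i) = X * (\<Sum>i\<in>UNIV. cos (\<theta> $ i)) + Y * (\<Sum>i\<in>UNIV. sin (\<theta> $ i))"
    by (simp add: *(1) sum.distrib sum_distrib_left)
  also have "\<dots> = real CARD('n) * (X\<^sup>2 + Y\<^sup>2)"
    by (simp add: *(3,4) power2_eq_square algebra_simps)
  finally show ?thesis by (simp add: *(2))
qed

lemma sum_mean_sin:
  fixes \<theta> :: "real ^ 'n"
  shows "(\<Sum>i\<in>UNIV. mean_sin \<theta> i) = 0"
proof -
  obtain X Y where *:
    "\<And>i. mean_sin \<theta> i = Y * cos (\<theta> $ i) - X * sin (\<theta> $ i)"
    "(\<Sum>i\<in>UNIV. cos (\<theta> $ i)) = real CARD('n) * X"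
    "(\<Sum>i\<in>UNIV. sin (\<theta> $ i)) = real CARD('n) * Y"
    using mean_field_coordinates by metis
  have "(\<Sum>i\<in>UNIV. mean_sin \<theta> i) = Y * (\<Sum>i\<in>UNIV. cos (\<theta> $ i)) - X * (\<Sum>i\<in>UNIV. sin (\<theta> $ i))"
    by (simp add: *(1) sum_subtractf sum_distrib_left)
  then show ?thesis
    by (simp add: * algebra_simps)
qed

lemma order_parameter_square_le_1: "(order_parameter \<theta>)\<^sup>2 \<le> 1"
proof -
  have "cmod (\<Sum>j\<in>UNIV. exp (\<i> * of_real (\<theta> $ j))) \<le> (\<Sum>j\<in>(UNIV::'a set). 1)"
    by (rule sum_norm_le) simp
  then have "order_parameter \<theta> \<le> 1" "0 \<le> order_parameter \<theta>"
    by (simp_all add: order_parameter_def norm_mult norm_divide divide_simps)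
  then show ?thesis by (simp add: power_le_one)
qed

section \<open>Elementary estimates\<close>

lemma abs_mean_le:
  fixes f :: "'n::finite \<Rightarrow> real"
  assumes "\<And>j. \<bar>f j\<bar> \<le> b"
  shows "\<bar>(\<Sum>j\<in>UNIV. f j) / real CARD('n)\<bar> \<le> b"
proof -
  have "\<bar>\<Sum>j\<in>UNIV. f j\<bar> \<le> (\<Sum>j\<in>(UNIV::'n set). b)"
    by (rule order_trans[OF sum_abs]) (intro sum_mono assms)
  then show ?thesis by (simp add: divide_simps mult.commute)
qed

lemma abs_mean_sin_le_1: "\<bar>mean_sin \<theta> i\<bar> \<le> 1"
  unfolding mean_sin_def by (rule abs_mean_le) simp

lemma abs_mean_cos_le_1: "\<bar>mean_cos \<theta> i\<bar> \<le> 1"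
  unfolding mean_cos_def by (rule abs_mean_le) simp

lemma abs_sin_diff_le: "\<bar>sin x - sin y\<bar> \<le> \<bar>x - y\<bar>" for x y :: real
proof -
  have "sin x - sin y = 2 * sin ((x - y) / 2) * cos ((x + y) / 2)"
    by (simp add: sin_diff_sin)
  then have "\<bar>sin x - sin y\<bar> = 2 * \<bar>sin ((x - y) / 2)\<bar> * \<bar>cos ((x + y) / 2)\<bar>"
    by (simp add: abs_mult)
  also have "\<dots> \<le> 2 * \<bar>(x - y) / 2\<bar> * 1"
    using abs_sin_x_le_abs_x[of "(x - y) / 2"] by (intro mult_mono) auto
  finally show ?thesis by simp
qed

lemma abs_cos_diff_le: "\<bar>cos x - cos y\<bar> \<le> \<bar>x - y\<bar>" for x y :: real
  using abs_sin_diff_le[of "x + pi/2" "y + pi/2"] by (simp add: sin_add)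

lemma cos_linear_approx: "\<bar>cos (x + w) - (cos x - w * sin x)\<bar> \<le> w\<^sup>2 / 2" for x w :: real
proof -
  define f :: "nat \<Rightarrow> real \<Rightarrow> real" where "f = (\<lambda>m. if m = 0 then cos else if m = 1 then (\<lambda>t. - sin t) else (\<lambda>t. - cos t))"
  have D: "((\<lambda>s. f m (x + s)) has_real_derivative f (Suc m) (x + s)) (at s)" if "m < 2" for m s
  proof -
    have "m = 0 \<or> m = 1" using that by auto
    then show ?thesis by (auto simp: f_def intro!: derivative_eq_intros)
  qed
  have "\<exists>t. \<bar>t\<bar> \<le> \<bar>w\<bar> \<and> f 0 (x + w) = (\<Sum>m<2. f m (x + 0) / fact m * w ^ m) + f 2 (x + t) / fact 2 * w ^ 2"
    by (rule Maclaurin_bi_le[where f = "\<lambda>s. f 0 (x + s)" and diff = "\<lambda>m s. f m (x + s)"])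
      (use D in auto)
  then obtain t where "cos (x + w) = cos x - w * sin x - cos (x + t) / 2 * w\<^sup>2"
    by (auto simp: f_def numeral_2_eq_2 algebra_simps)
  then have "\<bar>cos (x + w) - (cos x - w * sin x)\<bar> = \<bar>cos (x + t)\<bar> / 2 * w\<^sup>2"
    by (simp add: abs_mult)
  also have "\<dots> \<le> 1 / 2 * w\<^sup>2" by (intro mult_right_mono) auto
  finally show ?thesis by simp
qed

section \<open>Orbits with small steps and small frequencies\<close>

text \<open>With \<open>\<eta> = h * K\<close> and \<open>\<omega> = \<Omega> / K\<close> the scheme depends on \<open>K\<close> and \<open>h\<close> through \<open>\<eta>\<close> and
  \<open>\<omega>\<close> only. A single \<open>\<mu>\<close> bounds the step and the frequencies, since both perturb the continuous
  flow of identical oscillators by an amount of order \<open>\<mu> * (n * \<eta>)\<close> after the time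
  \<open>n * \<eta>\<close>, as long as that time is bounded. Large \<open>K\<close> and small \<open>h\<close> make \<open>\<mu>\<close> small.\<close>

definition slow_orbit :: "real \<Rightarrow> real \<Rightarrow> real ^ 'n \<Rightarrow> (nat \<Rightarrow> real ^ 'n) \<Rightarrow> bool" where
  "slow_orbit \<mu> \<eta> \<omega> \<theta> \<longleftrightarrow> 0 < \<eta> \<and> \<eta> \<le> \<mu> \<and> \<mu> \<le> 1/8 \<and> (\<forall>i. \<bar>\<omega> $ i\<bar> \<le> \<mu>) \<and>
     (\<forall>n i. \<theta> (Suc n) $ i = \<theta> n $ i + \<eta> * (\<omega> $ i + mean_sin (\<theta> n) i))"

lemma slow_orbitD:
  assumes "slow_orbit \<mu> \<eta> \<omega> \<theta>"
  shows "0 < \<eta>" "\<eta> \<le> \<mu>" "\<mu> \<le> 1/8" "\<And>i. \<bar>\<omega> $ i\<bar> \<le> \<mu>"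
    "\<And>n i. \<theta> (Suc n) $ i = \<theta> n $ i + \<eta> * (\<omega> $ i + mean_sin (\<theta> n) i)"
  using assms by (auto simp: slow_orbit_def)

lemma slow_orbit_shift: "slow_orbit \<mu> \<eta> \<omega> \<theta> \<Longrightarrow> slow_orbit \<mu> \<eta> \<omega> (\<lambda>n. \<theta> (m + n))"
  by (auto simp: slow_orbit_def)

lemma slow_orbit_mono: "slow_orbit \<mu> \<eta> \<omega> \<theta> \<Longrightarrow> \<mu> \<le> \<nu> \<Longrightarrow> \<nu> \<le> 1/8 \<Longrightarrow> slow_orbit \<nu> \<eta> \<omega> \<theta>"
  by (auto simp: slow_orbit_def intro: order_trans)

lemma slow_orbit_step_le:
  assumes "slow_orbit \<mu> \<eta> \<omega> \<theta>"
  shows "\<bar>\<theta> (Suc n) $ i - \<theta> n $ i\<bar> \<le> 2 * \<eta>"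
proof -
  note o = slow_orbitD[OF assms]
  have "\<bar>\<omega> $ i + mean_sin (\<theta> n) i\<bar> \<le> 2"
    using o(4)[of i] o(3) abs_mean_sin_le_1[of "\<theta> n" i] by linarith
  then have "\<eta> * \<bar>\<omega> $ i + mean_sin (\<theta> n) i\<bar> \<le> \<eta> * 2"
    using o(1) by (intro mult_left_mono) auto
  then show ?thesis using o(1) by (simp add: o(5) abs_mult)
qed

lemma slow_orbit_mean_diff_le:
  assumes "slow_orbit \<mu> \<eta> \<omega> \<theta>"
  shows "\<bar>mean_sin (\<theta> (Suc n)) i - mean_sin (\<theta> n) i\<bar> \<le> 4 * \<eta>"
    and "\<bar>mean_cos (\<theta> (Suc n)) i - mean_cos (\<theta> n) i\<bar> \<le> 4 * \<eta>"
proof -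
  have *: "\<bar>(\<theta> (Suc n) $ j - \<theta> (Suc n) $ i) - (\<theta> n $ j - \<theta> n $ i)\<bar> \<le> 4 * \<eta>" for j
    using slow_orbit_step_le[OF assms, of n i] slow_orbit_step_le[OF assms, of n j] by linarith
  show "\<bar>mean_sin (\<theta> (Suc n)) i - mean_sin (\<theta> n) i\<bar> \<le> 4 * \<eta>"
    unfolding mean_sin_def diff_divide_distrib[symmetric] sum_subtractf[symmetric]
    by (rule abs_mean_le) (rule order_trans[OF abs_sin_diff_le *])
  show "\<bar>mean_cos (\<theta> (Suc n)) i - mean_cos (\<theta> n) i\<bar> \<le> 4 * \<eta>"
    unfolding mean_cos_def diff_divide_distrib[symmetric] sum_subtractf[symmetric]
    by (rule abs_mean_le) (rule order_trans[OF abs_cos_diff_le *])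
qed

text \<open>Taylor expansion of one step. The frequencies contribute at most \<open>2 * \<mu> * \<eta>\<close> to the error and
  the second-order term, with phase differences moving by at most \<open>4 * \<eta>\<close>, at most
  \<open>8 * \<mu> * \<eta>\<close>.\<close>

lemma slow_orbit_cos_step:
  assumes "slow_orbit \<mu> \<eta> \<omega> \<theta>"
  shows "\<bar>cos (\<theta> (Suc n) $ i - \<theta> (Suc n) $ j)
           - (cos (\<theta> n $ i - \<theta> n $ j)
              + \<eta> * ((1 - cos (\<theta> n $ i - \<theta> n $ j)) * (mean_cos (\<theta> n) i + mean_cos (\<theta> n) j)))\<bar>
         \<le> 10 * \<mu> * \<eta>"
proof -
  note o = slow_orbitD[OF assms]
  define x where "x = \<theta> n $ i - \<theta> n $ j"
  define w where "w = (\<theta> (Suc n) $ i - \<theta> n $ i) - (\<theta> (Suc n) $ j - \<theta> n $ j)"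
  have "\<bar>w\<bar> \<le> 4 * \<eta>"
    using slow_orbit_step_le[OF assms, of n i] slow_orbit_step_le[OF assms, of n j]
    by (simp add: w_def)
  then have "w\<^sup>2 \<le> (4 * \<eta>)\<^sup>2" using o(1) by (intro abs_le_square_iff[THEN iffD1]) simp
  also have "\<dots> \<le> 16 * \<mu> * \<eta>" using o(1,2) by (simp add: power2_eq_square)
  finally have w2: "w\<^sup>2 / 2 \<le> 8 * \<mu> * \<eta>" by simp
  have w: "w = \<eta> * (\<omega> $ i - \<omega> $ j) + \<eta> * (mean_sin (\<theta> n) i - mean_sin (\<theta> n) j)"
    by (simp add: w_def o(5) algebra_simps)
  have ws: "w * sin x = \<eta> * ((\<omega> $ i - \<omega> $ j) * sin x)
      - \<eta> * ((1 - cos x) * (mean_cos (\<theta> n) i + mean_cos (\<theta> n) j))"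
    using sin_times_mean_sin_diff[of "\<theta> n" i j] unfolding w x_def by algebra
  have "\<bar>(\<omega> $ i - \<omega> $ j) * sin x\<bar> \<le> (2 * \<mu>) * 1"
    unfolding abs_mult using o(4)[of i] o(4)[of j] by (intro mult_mono) auto
  then have "\<eta> * \<bar>(\<omega> $ i - \<omega> $ j) * sin x\<bar> \<le> \<eta> * (2 * \<mu>)"
    using o(1) by (intro mult_left_mono) auto
  then have e: "\<bar>\<eta> * ((\<omega> $ i - \<omega> $ j) * sin x)\<bar> \<le> 2 * \<mu> * \<eta>"
    using o(1) by (simp add: abs_mult mult.commute)
  have "\<theta> (Suc n) $ i - \<theta> (Suc n) $ j = x + w" by (simp add: x_def w_def)
  then show ?thesis
    using cos_linear_approx[of x w] w2 e ws unfolding x_def[symmetric] by (simp only: abs_le_iff) linarith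
qed

lemma order_parameter_square_eq_mean:
  fixes \<theta> :: "real ^ 'n"
  shows "(order_parameter \<theta>)\<^sup>2 = (\<Sum>i\<in>UNIV. \<Sum>j\<in>UNIV. cos (\<theta> $ i - \<theta> $ j)) / (real CARD('n))\<^sup>2"
proof -
  have "real CARD('n) * (order_parameter \<theta>)\<^sup>2
      = (\<Sum>i\<in>UNIV. \<Sum>j\<in>UNIV. cos (\<theta> $ i - \<theta> $ j)) / real CARD('n)"
    unfolding sum_mean_cos[symmetric] mean_cos_def sum_divide_distrib[symmetric]
    by (simp add: cos_diff mult.commute)
  then show ?thesis by (simp add: divide_simps power2_eq_square ac_simps)
qed

text \<open>Summing the drift of all pair cosines gives the growth rate of the squared order parameter,
  up to normalisation. It is nonnegative and vanishes only at bipolar configurations, where all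
  \<open>mean_sin\<close> are zero.\<close>

lemma order_parameter_production:
  fixes \<theta> :: "real ^ 'n"
  shows "(\<Sum>i\<in>UNIV. \<Sum>j\<in>UNIV. (1 - cos (\<theta> $ i - \<theta> $ j)) * (mean_cos \<theta> i + mean_cos \<theta> j))
         = 2 * real CARD('n) * (\<Sum>i\<in>UNIV. (mean_sin \<theta> i)\<^sup>2)"
proof -
  define N where "N = real CARD('n)"
  have N: "N > 0" by (simp add: N_def)
  have row: "(\<Sum>j\<in>UNIV. 1 - cos (\<theta> $ i - \<theta> $ j)) = N - N * mean_cos \<theta> i" for i
    using N by (simp add: sum_subtractf mean_cos_def N_def cos_diff mult.commute)
  have A: "(\<Sum>i\<in>UNIV. \<Sum>j\<in>UNIV. (1 - cos (\<theta> $ i - \<theta> $ j)) * mean_cos \<theta> i)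
      = (\<Sum>i\<in>UNIV. (N - N * mean_cos \<theta> i) * mean_cos \<theta> i)"
    by (simp add: row flip: sum_distrib_right)
  have "(\<Sum>i\<in>UNIV. \<Sum>j\<in>UNIV. (1 - cos (\<theta> $ i - \<theta> $ j)) * mean_cos \<theta> j)
      = (\<Sum>j\<in>UNIV. \<Sum>i\<in>UNIV. (1 - cos (\<theta> $ j - \<theta> $ i)) * mean_cos \<theta> j)"
    by (subst sum.swap) (simp add: cos_diff mult.commute)
  then have B: "(\<Sum>i\<in>UNIV. \<Sum>j\<in>UNIV. (1 - cos (\<theta> $ i - \<theta> $ j)) * mean_cos \<theta> j)
      = (\<Sum>i\<in>UNIV. (N - N * mean_cos \<theta> i) * mean_cos \<theta> i)"
    using A by simp
  have "(\<Sum>i\<in>UNIV. (N - N * mean_cos \<theta> i) * mean_cos \<theta> i)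
      = N * (\<Sum>i\<in>UNIV. mean_cos \<theta> i) - N * (\<Sum>i\<in>UNIV. (mean_cos \<theta> i)\<^sup>2)"
    by (simp add: sum_subtractf sum_distrib_left power2_eq_square algebra_simps)
  also have "\<dots> = N * (\<Sum>i\<in>UNIV. (order_parameter \<theta>)\<^sup>2 - (mean_cos \<theta> i)\<^sup>2)"
    by (simp add: sum_mean_cos sum_subtractf N_def algebra_simps)
  also have "\<dots> = N * (\<Sum>i\<in>UNIV. (mean_sin \<theta> i)\<^sup>2)"
  proof -
    have "(order_parameter \<theta>)\<^sup>2 - (mean_cos \<theta> i)\<^sup>2 = (mean_sin \<theta> i)\<^sup>2" for i
      using mean_cos_sin_squares[of \<theta> i] by simp
    then show ?thesis by simp
  qed
  finally show ?thesis
    using A B by (simp add: distrib_left sum.distrib N_def)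
qed

lemma slow_orbit_order_parameter_step:
  fixes \<theta> :: "nat \<Rightarrow> real ^ 'n"
  assumes "slow_orbit \<mu> \<eta> \<omega> \<theta>"
  shows "(order_parameter (\<theta> (Suc n)))\<^sup>2 \<ge> (order_parameter (\<theta> n))\<^sup>2
           + 2 * \<eta> / real CARD('n) * (\<Sum>i\<in>UNIV. (mean_sin (\<theta> n) i)\<^sup>2) - 10 * \<mu> * \<eta>"
proof -
  define N where "N = real CARD('n)"
  have N: "N > 0" by (simp add: N_def)
  let ?c = "\<lambda>n i j. cos (\<theta> n $ i - \<theta> n $ j)"
  let ?p = "\<lambda>i j. (1 - ?c n i j) * (mean_cos (\<theta> n) i + mean_cos (\<theta> n) j)"
  have "(\<Sum>i\<in>UNIV. \<Sum>j\<in>UNIV. ?c (Suc n) i j)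
      \<ge> (\<Sum>i\<in>UNIV. \<Sum>j\<in>UNIV. ?c n i j + \<eta> * ?p i j - 10 * \<mu> * \<eta>)"
    by (intro sum_mono) (use slow_orbit_cos_step[OF assms, of n] in \<open>smt (verit)\<close>)
  moreover have "(\<Sum>i\<in>(UNIV::'n set). \<Sum>j\<in>(UNIV::'n set). ?c n i j + \<eta> * ?p i j - 10 * \<mu> * \<eta>)
      = (\<Sum>i\<in>UNIV. \<Sum>j\<in>UNIV. ?c n i j) + \<eta> * (\<Sum>i\<in>UNIV. \<Sum>j\<in>UNIV. ?p i j) - N\<^sup>2 * (10 * \<mu> * \<eta>)"
    by (simp add: sum.distrib sum_subtractf N_def power2_eq_square flip: sum_distrib_left)
  ultimately have "(\<Sum>i\<in>UNIV. \<Sum>j\<in>UNIV. ?c (Suc n) i j) / N\<^sup>2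
      \<ge> ((\<Sum>i\<in>UNIV. \<Sum>j\<in>UNIV. ?c n i j) + \<eta> * (2 * N * (\<Sum>i\<in>UNIV. (mean_sin (\<theta> n) i)\<^sup>2))
          - N\<^sup>2 * (10 * \<mu> * \<eta>)) / N\<^sup>2"
    unfolding order_parameter_production N_def by (simp add: divide_right_mono)
  also have "((\<Sum>i\<in>UNIV. \<Sum>j\<in>UNIV. ?c n i j) + \<eta> * (2 * N * (\<Sum>i\<in>UNIV. (mean_sin (\<theta> n) i)\<^sup>2))
          - N\<^sup>2 * (10 * \<mu> * \<eta>)) / N\<^sup>2 = (\<Sum>i\<in>UNIV. \<Sum>j\<in>UNIV. ?c n i j) / N\<^sup>2 + 2 * \<eta> / N * (\<Sum>i\<in>UNIV. (mean_sin (\<theta> n) i)\<^sup>2) - 10 * \<mu> * \<eta>"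
    using N by (simp add: field_simps power2_eq_square)
  finally show ?thesis
    by (simp add: order_parameter_square_eq_mean N_def)
qed

section \<open>All oscillators but one cluster in bounded time\<close>

lemma slow_orbit_order_parameter_gain:
  fixes \<theta> :: "nat \<Rightarrow> real ^ 'n"
  assumes "slow_orbit \<mu> \<eta> \<omega> \<theta>" and "0 \<le> g" and "\<And>n. n < m \<Longrightarrow> g \<le> \<bar>mean_sin (\<theta> n) i\<bar>"
  shows "(order_parameter (\<theta> 0))\<^sup>2 + real m * \<eta> * (2 * g\<^sup>2 / real CARD('n) - 10 * \<mu>)
          \<le> (order_parameter (\<theta> m))\<^sup>2"
  using assms(3)
proof (induction m)
  case (Suc m)
  note o = slow_orbitD[OF assms(1)]
  have "g\<^sup>2 \<le> (mean_sin (\<theta> m) i)\<^sup>2"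
    using Suc.prems[of m] assms(2) by (simp add: abs_le_square_iff[symmetric])
  also have "\<dots> \<le> (\<Sum>i\<in>UNIV. (mean_sin (\<theta> m) i)\<^sup>2)"
    by (rule member_le_sum) auto
  finally have "2 * \<eta> / real CARD('n) * g\<^sup>2 \<le> 2 * \<eta> / real CARD('n) * (\<Sum>i\<in>UNIV. (mean_sin (\<theta> m) i)\<^sup>2)"
    using o(1) by (intro mult_left_mono) auto
  then have "(order_parameter (\<theta> m))\<^sup>2 + \<eta> * (2 * g\<^sup>2 / real CARD('n) - 10 * \<mu>)
      \<le> (order_parameter (\<theta> (Suc m)))\<^sup>2"
    using slow_orbit_order_parameter_step[OF assms(1), of m] by (simp add: algebra_simps)
  moreover have "real (Suc m) * \<eta> * c = real m * \<eta> * c + \<eta> * c" for c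
    by (simp add: algebra_simps)
  ultimately show ?case using Suc by fastforce
qed simp

lemma slow_orbit_order_parameter_drop:
  fixes \<theta> :: "nat \<Rightarrow> real ^ 'n"
  assumes "slow_orbit \<mu> \<eta> \<omega> \<theta>"
  shows "(order_parameter (\<theta> 0))\<^sup>2 - 10 * \<mu> * (real m * \<eta>) \<le> (order_parameter (\<theta> m))\<^sup>2"
  using slow_orbit_order_parameter_gain[OF assms, of 0 m] by (simp add: algebra_simps)

text \<open>A \<open>mean_sin\<close> that exceeds \<open>f\<close> once stays above \<open>f / 2\<close> for a time of order \<open>f\<close>,
  because it moves by at most \<open>4 * \<eta>\<close> per step. During that time the squared order parameter gains
  an amount of order \<open>f ^ 3 / CARD('n)\<close>, whatever the step size, up to errors of order \<open>\<mu>\<close>.\<close>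

lemma slow_orbit_burst:
  fixes \<theta> :: "nat \<Rightarrow> real ^ 'n"
  assumes "slow_orbit \<mu> \<eta> \<omega> \<theta>" and f: "0 < f" "f \<le> 1" "\<eta> \<le> f / 16" and big: "f < \<bar>mean_sin (\<theta> 0) i\<bar>"
  shows "\<exists>m. real m * \<eta> \<le> 1 \<and>
    (order_parameter (\<theta> 0))\<^sup>2 + f ^ 3 / (32 * real CARD('n)) - 10 * \<mu> \<le> (order_parameter (\<theta> m))\<^sup>2"
proof (intro exI conjI)
  note o = slow_orbitD[OF assms(1)]
  define N where "N = real CARD('n)"
  have N: "N > 0" by (simp add: N_def)
  \<comment> \<open>the number of steps after which a drift of \<open>4 * \<eta>\<close> per step can add up to \<open>f / 2\<close>\<close>
  define m where "m = nat \<lfloor>f / (8 * \<eta>)\<rfloor>"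
  have "0 \<le> f / (8 * \<eta>)" using f o by simp
  then have "real m \<le> f / (8 * \<eta>)" "f / (8 * \<eta>) - 1 \<le> real m"
    unfolding m_def by linarith+
  then have up: "real m * \<eta> \<le> f / 8" and "f / 8 - \<eta> \<le> real m * \<eta>"
    using o(1) by (simp_all add: field_simps)
  then have lo: "f / 16 \<le> real m * \<eta>" using f by linarith
  show "real m * \<eta> \<le> 1" using up f by linarith
  have drift: "f - 4 * \<eta> * real n \<le> \<bar>mean_sin (\<theta> n) i\<bar>" for n
  proof (induction n)
    case (Suc n)
    then show ?case using slow_orbit_mean_diff_le(1)[OF assms(1), of n i] by (simp add: algebra_simps)
  qed (use big in simp)
  have half: "f / 2 \<le> \<bar>mean_sin (\<theta> n) i\<bar>" if "n < m" for n
  proof -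
    have "\<eta> * real n \<le> \<eta> * real m" using that o(1) by simp
    then have "4 * \<eta> * real n \<le> f / 2" using up by (simp add: mult.commute)
    then show ?thesis using drift[of n] by linarith
  qed
  have "(order_parameter (\<theta> 0))\<^sup>2 + real m * \<eta> * (2 * (f/2)\<^sup>2 / N - 10 * \<mu>) \<le> (order_parameter (\<theta> m))\<^sup>2"
    unfolding N_def by (rule slow_orbit_order_parameter_gain[OF assms(1) _ half]) (use f in auto)
  moreover have "f / 16 * (2 * (f/2)\<^sup>2 / N) \<le> real m * \<eta> * (2 * (f/2)\<^sup>2 / N)"
    using lo N by (intro mult_right_mono) auto
  moreover have "f / 16 * (2 * (f/2)\<^sup>2 / N) = f ^ 3 / (32 * N)"
    by (simp add: power2_eq_square power3_eq_cube)
  moreover have "real m * \<eta> * (10 * \<mu>) \<le> 1 * (10 * \<mu>)"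
    using \<open>real m * \<eta> \<le> 1\<close> o by (intro mult_right_mono) auto
  ultimately show "(order_parameter (\<theta> 0))\<^sup>2 + f ^ 3 / (32 * real CARD('n)) - 10 * \<mu> \<le> (order_parameter (\<theta> m))\<^sup>2"
    unfolding N_def[symmetric] by (simp add: right_diff_distrib)
qed

lemma exp_minus_double_le: "exp (- 2 * x) \<le> 1 - x" if "0 \<le> x" "x \<le> 1/2" for x :: real
proof -
  have "x * (1 - 2 * x) \<ge> 0" using that by simp
  then have "1 \<le> (1 + 2 * x) * (1 - x)" by (simp add: algebra_simps)
  also have "\<dots> \<le> exp (2 * x) * (1 - x)"
    using that exp_ge_add_one_self[of "2 * x"] by (intro mult_right_mono) auto
  finally show ?thesis by (simp add: exp_minus field_simps)
qed

text \<open>Two oscillators approach each other at most exponentially, because the logarithmic rate of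
  \<open>1 - cos (\<theta>\<^sub>i - \<theta>\<^sub>j)\<close> is at least \<open>- 2\<close>. After any bounded time, initially distinct
  oscillators are thus still separated, uniformly in the step size.\<close>

lemma slow_orbit_separation:
  assumes "slow_orbit \<mu> \<eta> \<omega> \<theta>" and "d \<le> 1 - cos (\<theta> 0 $ i - \<theta> 0 $ j)" and "0 \<le> d"
  shows "d * exp (- 4 * (real n * \<eta>)) - 10 * \<mu> * (real n * \<eta>) \<le> 1 - cos (\<theta> n $ i - \<theta> n $ j)"
proof -
  note o = slow_orbitD[OF assms(1)]
  have "d * (1 - 2 * \<eta>) ^ n - 10 * \<mu> * (real n * \<eta>) \<le> 1 - cos (\<theta> n $ i - \<theta> n $ j)"
  proof (induction n)
    case (Suc n)
    let ?D = "\<lambda>n. 1 - cos (\<theta> n $ i - \<theta> n $ j)"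
    have "mean_cos (\<theta> n) i + mean_cos (\<theta> n) j \<le> 2"
      using abs_mean_cos_le_1[of "\<theta> n" i] abs_mean_cos_le_1[of "\<theta> n" j] by linarith
    then have "\<eta> * (?D n * (mean_cos (\<theta> n) i + mean_cos (\<theta> n) j)) \<le> \<eta> * (?D n * 2)"
      using o(1) by (intro mult_left_mono) auto
    then have "?D n * (1 - 2 * \<eta>) - 10 * \<mu> * \<eta> \<le> ?D (Suc n)"
      using slow_orbit_cos_step[OF assms(1), of n i j] by (simp add: algebra_simps)
    moreover have "(d * (1 - 2 * \<eta>) ^ n - 10 * \<mu> * (real n * \<eta>)) * (1 - 2 * \<eta>) \<le> ?D n * (1 - 2 * \<eta>)"
      using Suc.IH o by (intro mult_right_mono) auto
    moreover have "0 \<le> 10 * \<mu> * (real n * \<eta>) * (2 * \<eta>)" using o by simp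
    ultimately show ?case by (simp add: algebra_simps)
  qed (use assms in simp)
  moreover have "exp (- 4 * (real n * \<eta>)) \<le> (1 - 2 * \<eta>) ^ n"
  proof -
    have "exp (- 2 * (2 * \<eta>)) ^ n \<le> (1 - 2 * \<eta>) ^ n"
      using o by (intro power_mono exp_minus_double_le) auto
    then show ?thesis by (simp add: exp_of_nat_mult[symmetric] algebra_simps)
  qed
  then have "d * exp (- 4 * (real n * \<eta>)) \<le> d * (1 - 2 * \<eta>) ^ n"
    using assms(3) by (intro mult_left_mono) auto
  ultimately show ?thesis by linarith
qed

definition clustered_on :: "'n set \<Rightarrow> real \<Rightarrow> real ^ 'n \<Rightarrow> bool" where
  "clustered_on S \<gamma> \<theta> \<longleftrightarrow> (\<forall>i\<in>S. \<forall>j\<in>S. 1 - \<gamma> \<le> cos (\<theta> $ i - \<theta> $ j))"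

text \<open>Oscillators aligned with the mean field are aligned with each other. This is the inner product of
  the vectors \<open>(mean_cos, mean_sin)\<close> of two oscillators, both close to
  \<open>(order_parameter, 0)\<close>.\<close>

lemma aligned_imp_clustered:
  assumes "0 < \<rho>" "\<rho>\<^sup>2 \<le> (order_parameter \<theta>)\<^sup>2" "0 < s" "s \<le> 1/2"
    and S: "\<And>i. i \<in> S \<Longrightarrow> 0 \<le> mean_cos \<theta> i \<and> \<bar>mean_sin \<theta> i\<bar> \<le> \<rho> * s"
  shows "clustered_on S (2 * s\<^sup>2) \<theta>"
  unfolding clustered_on_def
proof (intro ballI)
  fix i j assume ij: "i \<in> S" "j \<in> S"
  define E where "E = (order_parameter \<theta>)\<^sup>2"
  have E: "E > 0" "\<rho>\<^sup>2 \<le> E" using assms by (auto simp: E_def intro: less_le_trans[of 0 "\<rho>\<^sup>2"])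
  \<comment> \<open>lower bound for every \<open>mean_cos\<close> in \<open>S\<close>, as its square is at least \<open>E - (\<rho> * s)\<^sup>2\<close>\<close>
  define b where "b = sqrt (E - (\<rho> * s)\<^sup>2)"
  have "s\<^sup>2 \<le> 1" using assms by (simp add: power_le_one)
  then have "\<rho>\<^sup>2 * s\<^sup>2 \<le> \<rho>\<^sup>2 * 1" by (intro mult_left_mono) auto
  then have le: "(\<rho> * s)\<^sup>2 \<le> E" using E by (simp add: power_mult_distrib)
  have b: "b \<le> mean_cos \<theta> k" if "k \<in> S" for k
  proof -
    have "(mean_sin \<theta> k)\<^sup>2 \<le> (\<rho> * s)\<^sup>2" using S[OF that] by (intro abs_le_square_iff[THEN iffD1]) auto
    then have "E - (\<rho> * s)\<^sup>2 \<le> (mean_cos \<theta> k)\<^sup>2"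
      using mean_cos_sin_squares[of \<theta> k] by (simp add: E_def)
    then show ?thesis unfolding b_def using S[OF that] by (intro real_le_lsqrt) auto
  qed
  have "b * b \<le> mean_cos \<theta> i * mean_cos \<theta> j"
    using b[OF ij(1)] b[OF ij(2)] S[OF ij(1)] le by (intro mult_mono) (auto simp: b_def)
  moreover have "b * b = E - (\<rho> * s)\<^sup>2" using le by (simp add: b_def)
  moreover have "\<bar>mean_sin \<theta> i * mean_sin \<theta> j\<bar> \<le> (\<rho> * s) * (\<rho> * s)"
    unfolding abs_mult using S[OF ij(1)] S[OF ij(2)] assms by (intro mult_mono) auto
  ultimately have "E - 2 * (\<rho>\<^sup>2 * s\<^sup>2) \<le> E * cos (\<theta> $ i - \<theta> $ j)"
    using mean_cos_sin_inner[of \<theta> i j] by (simp add: E_def power2_eq_square algebra_simps abs_le_iff)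
  moreover have "\<rho>\<^sup>2 * s\<^sup>2 \<le> E * s\<^sup>2" using E by (intro mult_right_mono) auto
  ultimately have "E * (1 - 2 * s\<^sup>2) \<le> E * cos (\<theta> $ i - \<theta> $ j)" by (simp add: algebra_simps)
  then show "1 - 2 * s\<^sup>2 \<le> cos (\<theta> $ i - \<theta> $ j)" using E by simp
qed

text \<open>Two oscillators on the antipodal side repel each other, so they cannot both stay there: their
  separation \<open>1 - cos (\<theta>\<^sub>i - \<theta>\<^sub>j)\<close> grows at rate at least \<open>\<rho> * d / 2\<close> but never exceeds 2.
  The gap in the values of \<open>mean_cos\<close>, wider than one step can cross, keeps them on that side.\<close>

lemma two_antipodal_expel:
  fixes \<theta> :: "nat \<Rightarrow> real ^ 'n"
  assumes "slow_orbit \<mu> \<eta> \<omega> \<theta>" and pos: "0 < \<rho>" "0 < d"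
    and sep: "d \<le> 1 - cos (\<theta> 0 $ i - \<theta> 0 $ j)"
    and neg: "mean_cos (\<theta> 0) i < 0" "mean_cos (\<theta> 0) j < 0"
    and away: "\<And>n k. n \<le> m \<Longrightarrow> \<rho> / 2 \<le> \<bar>mean_cos (\<theta> n) k\<bar>"
    and small: "4 * \<eta> < \<rho>" "10 * \<mu> \<le> \<rho> * d / 2"
  shows "real m * \<eta> < 4 / (\<rho> * d)"
proof -
  note o = slow_orbitD[OF assms(1)]
  have stay: "mean_cos (\<theta> n) k \<le> - \<rho> / 2" if "n \<le> m" "mean_cos (\<theta> 0) k < 0" for n k
    using that(1)
  proof (induction n)
    case 0
    then show ?case using away[of 0 k] that(2) by simp
  next
    case (Suc n)
    then show ?case
      using away[of "Suc n" k] slow_orbit_mean_diff_le(2)[OF assms(1), of n k] small by simp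
  qed
  let ?D = "\<lambda>n. 1 - cos (\<theta> n $ i - \<theta> n $ j)"
  have "d + real n * \<eta> * (\<rho> * d / 2) \<le> ?D n" if "n \<le> m" for n
    using that
  proof (induction n)
    case (Suc n)
    then have D: "d + real n * \<eta> * (\<rho> * d / 2) \<le> ?D n" by simp
    moreover have "0 \<le> real n * \<eta> * (\<rho> * d / 2)" using pos o by simp
    ultimately have "d \<le> ?D n" by linarith
    then have "d * \<rho> \<le> ?D n * (- (mean_cos (\<theta> n) i + mean_cos (\<theta> n) j))"
      using stay[OF _ neg(1), of n] stay[OF _ neg(2), of n] Suc.prems pos by (intro mult_mono) auto
    then have "\<eta> * (d * \<rho>) \<le> \<eta> * (?D n * (- (mean_cos (\<theta> n) i + mean_cos (\<theta> n) j)))"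
      using o(1) by (intro mult_left_mono) auto
    moreover have "\<eta> * (10 * \<mu>) \<le> \<eta> * (\<rho> * d / 2)" using small o by (intro mult_left_mono) auto
    ultimately have "?D n + \<eta> * (\<rho> * d / 2) \<le> ?D (Suc n)"
      using slow_orbit_cos_step[OF assms(1), of n i j] by (simp add: algebra_simps abs_le_iff)
    moreover have "real (Suc n) * \<eta> * (\<rho> * d / 2) = real n * \<eta> * (\<rho> * d / 2) + \<eta> * (\<rho> * d / 2)"
      by (simp add: algebra_simps)
    ultimately show ?case using D by linarith
  qed (use sep in simp)
  from this[of m] have "d + real m * \<eta> * (\<rho> * d / 2) \<le> 2"
    using cos_ge_minus_one[of "\<theta> m $ i - \<theta> m $ j"] by linarith
  then have "real m * \<eta> * (\<rho> * d) < 4" using pos by simp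
  then show ?thesis using pos by (simp add: field_simps)
qed

text \<open>Within the time in which two antipodal oscillators would have to separate, either some \<open>mean_sin\<close>
  becomes large, and a burst raises the order parameter, or the configuration stays bipolar. In the
  second case no two oscillators can have been antipodal at the start, so all but one are aligned.\<close>

lemma cluster_or_gain:
  fixes \<theta> :: "nat \<Rightarrow> real ^ 'n"
  assumes "slow_orbit \<mu> \<eta> \<omega> \<theta>" and \<rho>: "0 < \<rho>" "\<rho> \<le> 1" "\<rho>\<^sup>2 \<le> (order_parameter (\<theta> 0))\<^sup>2"
    and s: "0 < s" "s \<le> 1/2"
    and d: "0 < d" and sep: "\<And>i j. i \<noteq> j \<Longrightarrow> d \<le> 1 - cos (\<theta> 0 $ i - \<theta> 0 $ j)"
    and small: "\<mu> \<le> \<rho> * s / 16" "10 * \<mu> \<le> \<rho> * d / 2"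
      "10 * \<mu> * (4 / (\<rho> * d) + 2) \<le> (\<rho> * s) ^ 3 / (64 * real CARD('n))"
  shows "(\<exists>z. clustered_on (- {z}) (2 * s\<^sup>2) (\<theta> 0)) \<or>
    (\<exists>n. real n * \<eta> \<le> 4 / (\<rho> * d) + 2 \<and>
       (order_parameter (\<theta> 0))\<^sup>2 + (\<rho> * s) ^ 3 / (64 * real CARD('n)) \<le> (order_parameter (\<theta> n))\<^sup>2)"
proof -
  note o = slow_orbitD[OF assms(1)]
  define L where "L = 4 / (\<rho> * d)"
  define f where "f = \<rho> * s"
  define \<kappa> where "\<kappa> = f ^ 3 / (64 * real CARD('n))"
  define m where "m = nat \<lceil>L / \<eta>\<rceil>"
  have L: "L > 0" using \<rho> d by (simp add: L_def)
  have "\<rho> * s \<le> \<rho> * (1/2)" using \<rho> s by (intro mult_left_mono) auto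
  then have f: "0 < f" "f \<le> \<rho> / 2" using \<rho> s by (auto simp: f_def)
  have "0 \<le> L / \<eta>" using L o by simp
  then have "L / \<eta> \<le> real m" "real m \<le> L / \<eta> + 1" unfolding m_def by linarith+
  then have m: "L \<le> real m * \<eta>" "real m * \<eta> \<le> L + \<eta>"
    using o(1) by (simp_all add: field_simps)
  have time: "real n * \<eta> \<le> L + 1" if "n \<le> m" for n
  proof -
    have "real n * \<eta> \<le> real m * \<eta>" using that o by (intro mult_right_mono) auto
    then show ?thesis using m o by linarith
  qed
  have drop: "(order_parameter (\<theta> 0))\<^sup>2 - 10 * \<mu> * (L + 1) \<le> (order_parameter (\<theta> n))\<^sup>2" if "n \<le> m" for n
  proof -
    have "10 * \<mu> * (real n * \<eta>) \<le> 10 * \<mu> * (L + 1)" using time[OF that] o by (intro mult_left_mono) auto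
    then show ?thesis using slow_orbit_order_parameter_drop[OF assms(1), of n] by linarith
  qed
  show ?thesis
  proof (cases "\<exists>n\<le>m. \<exists>i. f < \<bar>mean_sin (\<theta> n) i\<bar>")
    case True
    then obtain n i where n: "n \<le> m" and big: "f < \<bar>mean_sin (\<theta> n) i\<bar>" by blast
    obtain q where q: "real q * \<eta> \<le> 1"
      "(order_parameter (\<theta> n))\<^sup>2 + f ^ 3 / (32 * real CARD('n)) - 10 * \<mu> \<le> (order_parameter (\<theta> (n + q)))\<^sup>2"
      using slow_orbit_burst[OF slow_orbit_shift[OF assms(1), of n], of f i] f \<rho> big small(1) o(2)
      by (auto simp flip: f_def)
    have "real (n + q) * \<eta> \<le> L + 2" using time[OF n] q(1) by (simp add: algebra_simps)
    moreover have "(order_parameter (\<theta> 0))\<^sup>2 + \<kappa> \<le> (order_parameter (\<theta> (n + q)))\<^sup>2"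
    proof -
      have "f ^ 3 / (32 * real CARD('n)) = 2 * \<kappa>" by (simp add: \<kappa>_def)
      moreover have "10 * \<mu> * (L + 2) \<le> \<kappa>" using small(3) by (simp add: L_def \<kappa>_def f_def)
      moreover have "10 * \<mu> * (L + 2) = 10 * \<mu> * (L + 1) + 10 * \<mu>" by (simp add: algebra_simps)
      ultimately show ?thesis using q(2) drop[OF n] by linarith
    qed
    ultimately show ?thesis unfolding L_def \<kappa>_def f_def by blast
  next
    case False
    then have calm: "\<bar>mean_sin (\<theta> n) i\<bar> \<le> f" if "n \<le> m" for n i
      using that by (meson not_le)
    show ?thesis
    proof (cases "\<exists>z. \<forall>i. i \<noteq> z \<longrightarrow> 0 \<le> mean_cos (\<theta> 0) i")
      case True
      then obtain z where z: "\<And>i. i \<noteq> z \<Longrightarrow> 0 \<le> mean_cos (\<theta> 0) i" by blast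
      have "clustered_on (- {z}) (2 * s\<^sup>2) (\<theta> 0)"
        by (rule aligned_imp_clustered[OF \<rho>(1,3) s]) (use z calm[of 0] in \<open>auto simp: f_def\<close>)
      then show ?thesis by blast
    next
      case False
      then obtain i j where ij: "i \<noteq> j" "mean_cos (\<theta> 0) i < 0" "mean_cos (\<theta> 0) j < 0"
        by (metis not_le)
      have "f ^ 3 \<le> \<rho>\<^sup>2 / 4"
      proof -
        have "f ^ 3 \<le> (\<rho> / 2) ^ 3" using f by (intro power_mono) auto
        also have "\<dots> = (\<rho> / 2)\<^sup>2 * (\<rho> / 2)" by (simp add: power3_eq_cube power2_eq_square)
        also have "\<dots> \<le> (\<rho> / 2)\<^sup>2 * 1" using \<rho> by (intro mult_left_mono) auto
        finally show ?thesis by (simp add: power_divide)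
      qed
      moreover have "\<kappa> \<le> f ^ 3"
      proof -
        have "1 \<le> real CARD('n)" by (simp add: Suc_le_eq)
        then have "1 \<le> 64 * real CARD('n)" by linarith
        then have "\<kappa> \<le> f ^ 3 / 1" unfolding \<kappa>_def by (rule divide_left_mono) (use f in auto)
        then show ?thesis by simp
      qed
      moreover have "10 * \<mu> * (L + 1) \<le> 10 * \<mu> * (L + 2)" using o by simp
      ultimately have err: "10 * \<mu> * (L + 1) \<le> \<rho>\<^sup>2 / 4"
        using small(3) by (simp add: L_def \<kappa>_def f_def)
      have "\<rho> / 2 \<le> \<bar>mean_cos (\<theta> n) k\<bar>" if "n \<le> m" for n k
      proof -
        have "(mean_sin (\<theta> n) k)\<^sup>2 \<le> (\<rho> / 2)\<^sup>2"
          using calm[OF that, of k] f by (intro abs_le_square_iff[THEN iffD1]) auto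
        moreover have q: "(\<rho> / 2)\<^sup>2 = \<rho>\<^sup>2 / 4" by (simp add: power_divide)
        ultimately have "(\<rho> / 2)\<^sup>2 \<le> (mean_cos (\<theta> n) k)\<^sup>2"
          using mean_cos_sin_squares[of "\<theta> n" k] drop[OF that] err \<rho>(3) zero_le_power2[of \<rho>]
          unfolding q by linarith
        then show ?thesis using \<rho> by (simp add: abs_le_square_iff[symmetric])
      qed
      then have "real m * \<eta> < 4 / (\<rho> * d)"
        using two_antipodal_expel[OF assms(1) \<rho>(1) d sep[OF ij(1)] ij(2,3), of m] small f o
        by (simp add: f_def)
      then show ?thesis using m(1) by (simp add: L_def)
    qed
  qed
qed

text \<open>The squared order parameter is at most 1, so the gain in the previous lemma, whose size does not
  depend on the separation \<open>d\<close>, occurs only finitely often. The induction is on the number of gains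
  still possible; the separation shrinks from one round to the next, and with it the
  admissible \<open>\<mu>\<close>.\<close>

lemma eventually_clustered:
  fixes \<rho> s d :: real
  assumes \<rho>: "0 < \<rho>" "\<rho> \<le> 1" and s: "0 < s" "s \<le> 1/2" and "0 < d"
  shows "\<exists>\<mu>>0. \<mu> \<le> 1/8 \<and> (\<forall>\<eta> \<omega> (\<theta> :: nat \<Rightarrow> real ^ 'n). slow_orbit \<mu> \<eta> \<omega> \<theta> \<longrightarrow>
           \<rho>\<^sup>2 \<le> (order_parameter (\<theta> 0))\<^sup>2 \<longrightarrow> (\<forall>i j. i \<noteq> j \<longrightarrow> d \<le> 1 - cos (\<theta> 0 $ i - \<theta> 0 $ j)) \<longrightarrow>
           (\<exists>n z. clustered_on (- {z}) (2 * s\<^sup>2) (\<theta> n)))"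
proof -
  define \<kappa> where "\<kappa> = (\<rho> * s) ^ 3 / (64 * real CARD('n))"
  have \<kappa>: "\<kappa> > 0" using \<rho> s by (simp add: \<kappa>_def)
  define goal where "goal = (\<lambda>k d \<mu>. \<forall>\<eta> \<omega> (\<theta> :: nat \<Rightarrow> real ^ 'n). slow_orbit \<mu> \<eta> \<omega> \<theta> \<longrightarrow>
      1 < (order_parameter (\<theta> 0))\<^sup>2 + real k * \<kappa> \<longrightarrow>
      \<rho>\<^sup>2 \<le> (order_parameter (\<theta> 0))\<^sup>2 \<longrightarrow> (\<forall>i j. i \<noteq> j \<longrightarrow> d \<le> 1 - cos (\<theta> 0 $ i - \<theta> 0 $ j)) \<longrightarrow>
      (\<exists>n z. clustered_on (- {z}) (2 * s\<^sup>2) (\<theta> n)))"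
  have main: "\<exists>\<mu>. 0 < \<mu> \<and> \<mu> \<le> 1/8 \<and> goal k d \<mu>" if "0 < d" for k d
    using that
  proof (induction k arbitrary: d)
    case 0
    have "goal 0 d (1/8)"
      unfolding goal_def using order_parameter_square_le_1 by (auto simp: not_less[symmetric])
    then show ?case by (intro exI[of _ "1/8"]) auto
  next
    case (Suc k)
    define L where "L = 4 / (\<rho> * d) + 2"
    \<comment> \<open>half of what the separation is guaranteed after time \<open>L\<close>; the other half absorbs the errors\<close>
    define d' where "d' = d * exp (- 4 * L) / 2"
    have pos: "L > 0" "d' > 0" using \<rho> Suc.prems by (auto simp: L_def d'_def add_pos_pos)
    obtain \<nu> where \<nu>: "\<nu> > 0" "\<nu> \<le> 1/8" "goal k d' \<nu>" using Suc.IH[OF pos(2)] by blast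
    \<comment> \<open>the five bounds serve, in order, the next round, the bursts, the repulsion, the gain and the separation\<close>
    define \<mu> where "\<mu> = Min {\<nu>, \<rho> * s / 16, \<rho> * d / 20, \<kappa> / (10 * L), d' / (10 * L)}"
    have "\<mu> > 0" using \<nu> \<rho> s \<kappa> Suc.prems pos by (simp add: \<mu>_def)
    have "\<mu> \<le> \<nu>" "\<mu> \<le> \<rho> * s / 16" "\<mu> \<le> \<rho> * d / 20" "\<mu> \<le> \<kappa> / (10 * L)" "\<mu> \<le> d' / (10 * L)"
      unfolding \<mu>_def by (rule Min_le; simp)+
    then have \<mu>: "\<mu> \<le> \<nu>" "\<mu> \<le> \<rho> * s / 16" "10 * \<mu> \<le> \<rho> * d / 2" "10 * \<mu> * L \<le> \<kappa>" "10 * \<mu> * L \<le> d'"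
      using pos by (simp_all add: pos_le_divide_eq ac_simps)
    have "goal (Suc k) d \<mu>"
      unfolding goal_def
    proof (intro allI impI)
      fix \<eta> \<omega> and \<theta> :: "nat \<Rightarrow> real ^ 'n"
      assume orb: "slow_orbit \<mu> \<eta> \<omega> \<theta>"
        and E: "1 < (order_parameter (\<theta> 0))\<^sup>2 + real (Suc k) * \<kappa>" "\<rho>\<^sup>2 \<le> (order_parameter (\<theta> 0))\<^sup>2"
        and sep: "\<forall>i j. i \<noteq> j \<longrightarrow> d \<le> 1 - cos (\<theta> 0 $ i - \<theta> 0 $ j)"
      note o = slow_orbitD[OF orb]
      consider z where "clustered_on (- {z}) (2 * s\<^sup>2) (\<theta> 0)"
        | n where "real n * \<eta> \<le> L" "(order_parameter (\<theta> 0))\<^sup>2 + \<kappa> \<le> (order_parameter (\<theta> n))\<^sup>2"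
        using cluster_or_gain[OF orb \<rho> E(2) s Suc.prems] sep \<mu> unfolding L_def \<kappa>_def by blast
      then show "\<exists>n z. clustered_on (- {z}) (2 * s\<^sup>2) (\<theta> n)"
      proof cases
        case 1
        then show ?thesis by blast
      next
        case (2 n)
        have sep': "\<forall>i j. i \<noteq> j \<longrightarrow> d' \<le> 1 - cos (\<theta> (n + 0) $ i - \<theta> (n + 0) $ j)"
        proof (intro allI impI)
          fix i j :: 'n assume "i \<noteq> j"
          have "d * exp (- 4 * L) \<le> d * exp (- 4 * (real n * \<eta>))"
            using 2(1) Suc.prems by (intro mult_left_mono) auto
          moreover have "10 * \<mu> * (real n * \<eta>) \<le> 10 * \<mu> * L"
            using 2(1) \<open>\<mu> > 0\<close> by (intro mult_left_mono) auto
          moreover have "d * exp (- 4 * L) = 2 * d'" by (simp add: d'_def)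
          moreover have "d * exp (- 4 * (real n * \<eta>)) - 10 * \<mu> * (real n * \<eta>) \<le> 1 - cos (\<theta> n $ i - \<theta> n $ j)"
            using slow_orbit_separation[OF orb, of d i j n] sep \<open>i \<noteq> j\<close> Suc.prems by simp
          ultimately show "d' \<le> 1 - cos (\<theta> (n + 0) $ i - \<theta> (n + 0) $ j)"
            using \<mu>(5) by simp
        qed
        have "slow_orbit \<nu> \<eta> \<omega> (\<lambda>k. \<theta> (n + k))"
          by (rule slow_orbit_mono[OF slow_orbit_shift[OF orb] \<mu>(1) \<nu>(2)])
        moreover have "real (Suc k) * \<kappa> = real k * \<kappa> + \<kappa>" by (simp add: algebra_simps)
        then have "1 < (order_parameter (\<theta> (n + 0)))\<^sup>2 + real k * \<kappa>"
          "\<rho>\<^sup>2 \<le> (order_parameter (\<theta> (n + 0)))\<^sup>2"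
          using 2(2) E \<kappa> by simp_all
        ultimately show ?thesis
          using \<nu>(3)[unfolded goal_def, rule_format, of \<eta> \<omega> "\<lambda>k. \<theta> (n + k)"] sep' by blast
      qed
    qed
    then show ?case using \<open>\<mu> > 0\<close> \<mu>(1) \<nu>(2) by fastforce
  qed
  obtain k where k: "1 < real k * \<kappa>"
    using \<kappa> ex_less_of_nat_mult by blast
  obtain \<mu> where \<mu>: "0 < \<mu>" "\<mu> \<le> 1/8" "goal k d \<mu>" using main[OF \<open>0 < d\<close>] by blast
  have "1 < (order_parameter \<theta>)\<^sup>2 + real k * \<kappa>" for \<theta> :: "real ^ 'n"
    using k zero_le_power2[of "order_parameter \<theta>"] by linarith
  with \<mu> show ?thesis unfolding goal_def by blast
qed

section \<open>Clusters are trapped; the outsider leaves or stays antipodal\<close>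

text \<open>A cluster of all oscillators but one is a majority as soon as there are three oscillators, so the
  mean field pulls towards it even when the remaining oscillator sits opposite.\<close>

lemma clustered_on_mean_cos_ge:
  fixes \<theta> :: "real ^ 'n"
  assumes "CARD('n) \<ge> 3" and "card (- S) \<le> 1" and "clustered_on S \<gamma> \<theta>" "\<gamma> \<le> 1/4" and i: "i \<in> S"
  shows "1/6 \<le> mean_cos \<theta> i"
proof -
  define N where "N = real CARD('n)"
  define c where "c = real (card (- S))"
  have N: "N \<ge> 3" and c: "c \<le> 1" using assms by (simp_all add: N_def c_def)
  have "card S + card (- S) = CARD('n)"
    using card_Un_disjoint[of S "- S"] by (simp add: Compl_partition)
  then have cS: "real (card S) = N - c" unfolding N_def c_def by linarith
  have "(\<Sum>j\<in>UNIV. cos (\<theta> $ j - \<theta> $ i))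
      = (\<Sum>j\<in>S. cos (\<theta> $ j - \<theta> $ i)) + (\<Sum>j\<in>-S. cos (\<theta> $ j - \<theta> $ i))"
    using sum.union_disjoint[of S "- S" "\<lambda>j. cos (\<theta> $ j - \<theta> $ i)"] by (simp add: Compl_partition)
  moreover have "(\<Sum>j\<in>S. 3/4) \<le> (\<Sum>j\<in>S. cos (\<theta> $ j - \<theta> $ i))"
  proof (intro sum_mono)
    fix j assume "j \<in> S"
    then have "1 - \<gamma> \<le> cos (\<theta> $ j - \<theta> $ i)" using assms(3) i by (auto simp: clustered_on_def)
    then show "3/4 \<le> cos (\<theta> $ j - \<theta> $ i)" using assms(4) by linarith
  qed
  moreover have "(\<Sum>j\<in>-S. -1) \<le> (\<Sum>j\<in>-S. cos (\<theta> $ j - \<theta> $ i))"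
    by (intro sum_mono) simp
  ultimately have "(N - c) * (3/4) - c \<le> (\<Sum>j\<in>UNIV. cos (\<theta> $ j - \<theta> $ i))"
    unfolding sum_constant cS c_def[symmetric] by linarith
  then have "N * (1/6) \<le> (\<Sum>j\<in>UNIV. cos (\<theta> $ j - \<theta> $ i))" using N c by (simp add: algebra_simps)
  then show ?thesis using N by (simp add: mean_cos_def N_def[symmetric] field_simps)
qed

text \<open>Inside a cluster both \<open>mean_cos\<close> are at least \<open>1/6\<close>, so the separation of a pair contracts
  at rate \<open>1/3\<close>, which beats the error term at the boundary value \<open>\<gamma>\<close>.\<close>

lemma slow_orbit_clustered_stays:
  fixes \<theta> :: "nat \<Rightarrow> real ^ 'n"
  assumes orb: "slow_orbit \<mu> \<eta> \<omega> \<theta>" and "CARD('n) \<ge> 3" and "card (- S) \<le> 1"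
    and \<gamma>: "\<gamma> \<le> 1/4" "30 * \<mu> \<le> \<gamma>" and "clustered_on S \<gamma> (\<theta> 0)"
  shows "clustered_on S \<gamma> (\<theta> n)"
proof (induction n)
  case (Suc n)
  note o = slow_orbitD[OF orb]
  show ?case
    unfolding clustered_on_def
  proof (intro ballI)
    fix i j assume ij: "i \<in> S" "j \<in> S"
    let ?D = "\<lambda>n. 1 - cos (\<theta> n $ i - \<theta> n $ j)"
    have D: "?D n \<le> \<gamma>" using Suc ij unfolding clustered_on_def by fastforce
    have "1/3 \<le> mean_cos (\<theta> n) i + mean_cos (\<theta> n) j"
      using clustered_on_mean_cos_ge[OF assms(2,3) Suc \<gamma>(1) ij(1)]
        clustered_on_mean_cos_ge[OF assms(2,3) Suc \<gamma>(1) ij(2)] by simp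
    then have "\<eta> * (?D n * (1/3)) \<le> \<eta> * (?D n * (mean_cos (\<theta> n) i + mean_cos (\<theta> n) j))"
      using o(1) by (intro mult_left_mono) auto
    moreover have "\<bar>cos (\<theta> (Suc n) $ i - \<theta> (Suc n) $ j) - (cos (\<theta> n $ i - \<theta> n $ j)
        + \<eta> * (?D n * (mean_cos (\<theta> n) i + mean_cos (\<theta> n) j)))\<bar> \<le> 10 * \<mu> * \<eta>"
      by (rule slow_orbit_cos_step[OF orb])
    ultimately have "?D (Suc n) \<le> ?D n - \<eta> * (?D n * (1/3)) + 10 * \<mu> * \<eta>"
      by linarith
    also have "\<dots> = ?D n * (1 - \<eta> / 3) + 10 * \<mu> * \<eta>" by (simp add: algebra_simps)
    also have "\<dots> \<le> \<gamma> * (1 - \<eta> / 3) + \<gamma> / 3 * \<eta>"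
      using D o \<gamma> by (intro add_mono mult_right_mono) auto
    also have "\<dots> = \<gamma>" by (simp add: algebra_simps)
    finally show "1 - \<gamma> \<le> cos (\<theta> (Suc n) $ i - \<theta> (Suc n) $ j)" by simp
  qed
qed (use assms in simp)

text \<open>Seen from outside, a tight cluster acts as one oscillator. Its tolerance is written
  \<open>\<tau>\<^sup>2 / 2\<close> because cosines within \<open>\<tau>\<^sup>2 / 2\<close> of 1 correspond to chords of length at
  most \<open>\<tau>\<close>.\<close>

lemma clustered_on_cos_to_outsider:
  assumes "clustered_on S (\<tau>\<^sup>2 / 2) \<theta>" "0 \<le> \<tau>" "i \<in> S" "k \<in> S"
  shows "\<bar>cos (\<theta> $ z - \<theta> $ i) - cos (\<theta> $ z - \<theta> $ k)\<bar> \<le> \<tau>"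
proof -
  let ?h = "(\<theta> $ i - \<theta> $ k) / 2"
  have "cos (\<theta> $ i - \<theta> $ k) = 1 - 2 * (sin ?h)\<^sup>2"
  proof -
    have "\<theta> $ i - \<theta> $ k = 2 * ?h" by simp
    then show ?thesis by (metis cos_double_sin)
  qed
  moreover have "1 - \<tau>\<^sup>2 / 2 \<le> cos (\<theta> $ i - \<theta> $ k)" using assms by (simp add: clustered_on_def)
  ultimately have "(2 * sin ?h)\<^sup>2 \<le> \<tau>\<^sup>2" by (simp add: power_mult_distrib)
  then have h: "\<bar>2 * sin ?h\<bar> \<le> \<tau>" using assms(2) by (metis abs_le_square_iff abs_of_nonneg)
  have "cos (\<theta> $ z - \<theta> $ i) - cos (\<theta> $ z - \<theta> $ k)
      = 2 * sin ?h * sin (((\<theta> $ z - \<theta> $ i) + (\<theta> $ z - \<theta> $ k)) / 2)"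
    by (simp add: cos_diff_cos)
  also have "\<bar>\<dots>\<bar> \<le> \<tau> * 1"
    unfolding abs_mult[of "2 * sin ?h"] using h assms(2) by (intro mult_mono) auto
  finally show ?thesis by simp
qed

lemma sum_split_point: "(\<Sum>j\<in>UNIV. f j) = f z + (\<Sum>j\<in>-{z}. f j)" for f :: "'n::finite \<Rightarrow> real"
  by (simp add: Compl_eq_Diff_UNIV sum.remove)

lemma card_Compl_point: "real (card (- {z :: 'n::finite})) = real CARD('n) - 1"
proof -
  have "Suc 0 \<le> CARD('n)" by (simp add: Suc_le_eq)
  then show ?thesis by (simp add: Compl_eq_Diff_UNIV of_nat_diff)
qed

lemma abs_sum_minus_const_le:
  fixes f :: "'a \<Rightarrow> real"
  assumes "\<And>j. j \<in> S \<Longrightarrow> \<bar>f j - c\<bar> \<le> b"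
  shows "\<bar>sum f S - real (card S) * c\<bar> \<le> real (card S) * b"
proof -
  have "sum f S - real (card S) * c = (\<Sum>j\<in>S. f j - c)" by (simp add: sum_subtractf)
  also have "\<bar>\<dots>\<bar> \<le> (\<Sum>j\<in>S. b)" by (rule order_trans[OF sum_abs]) (intro sum_mono assms)
  finally show ?thesis by simp
qed

text \<open>If the cluster were a single point at angle \<open>\<phi>\<close> from the outsider, the two values would be
  \<open>(1 + (N - 1) * cos \<phi>) / N\<close> and \<open>(cos \<phi> + N - 1) / N\<close>, which add up to
  \<open>1 + cos \<phi>\<close>.\<close>

lemma outsider_mean_cos:
  fixes \<theta> :: "real ^ 'n"
  assumes "clustered_on (- {z}) (\<tau>\<^sup>2 / 2) \<theta>" "0 \<le> \<tau>" "\<tau> \<le> 1" "j \<noteq> z"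
  shows "\<bar>mean_cos \<theta> z + mean_cos \<theta> j - (1 + cos (\<theta> $ z - \<theta> $ j))\<bar> \<le> 2 * \<tau>"
proof -
  define N where "N = real CARD('n)"
  have N: "N > 0" by (simp add: N_def)
  define c where "c = cos (\<theta> $ z - \<theta> $ j)"
  have sym: "cos (\<theta> $ k - \<theta> $ l) = cos (\<theta> $ l - \<theta> $ k)" for k l by (simp add: cos_diff mult.commute)
  have 1: "\<bar>(\<Sum>k\<in>-{z}. cos (\<theta> $ k - \<theta> $ z)) - (N - 1) * c\<bar> \<le> (N - 1) * \<tau>"
    unfolding N_def card_Compl_point[symmetric, of z] c_def sym[of _ z]
    by (rule abs_sum_minus_const_le, rule clustered_on_cos_to_outsider[OF assms(1,2)]) (use assms in auto)
  have 2: "\<bar>(\<Sum>k\<in>-{z}. cos (\<theta> $ k - \<theta> $ j)) - (N - 1) * 1\<bar> \<le> (N - 1) * \<tau>"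
    unfolding N_def card_Compl_point[symmetric, of z]
  proof (rule abs_sum_minus_const_le)
    fix k assume "k \<in> - {z}"
    then have "1 - \<tau>\<^sup>2 / 2 \<le> cos (\<theta> $ k - \<theta> $ j)" using assms by (simp add: clustered_on_def)
    moreover have "\<tau>\<^sup>2 / 2 \<le> \<tau>"
      using assms(2,3) mult_left_mono[of \<tau> 1 \<tau>] by (simp add: power2_eq_square)
    ultimately show "\<bar>cos (\<theta> $ k - \<theta> $ j) - 1\<bar> \<le> \<tau>" by simp
  qed
  have "N * mean_cos \<theta> z = 1 + (\<Sum>k\<in>-{z}. cos (\<theta> $ k - \<theta> $ z))"
    using N unfolding mean_cos_def N_def[symmetric] sum_split_point[of _ z] by simp
  moreover have "N * mean_cos \<theta> j = c + (\<Sum>k\<in>-{z}. cos (\<theta> $ k - \<theta> $ j))"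
    using N unfolding mean_cos_def N_def[symmetric] sum_split_point[of _ z] by (simp add: c_def)
  ultimately have "\<bar>N * mean_cos \<theta> z + N * mean_cos \<theta> j - (N + N * c)\<bar> \<le> 2 * (N * \<tau>)"
    using 1 2 assms(2) by (simp add: algebra_simps)
  also have "N * mean_cos \<theta> z + N * mean_cos \<theta> j - (N + N * c)
      = N * (mean_cos \<theta> z + mean_cos \<theta> j - (1 + c))" by (simp add: algebra_simps)
  finally have "N * \<bar>mean_cos \<theta> z + mean_cos \<theta> j - (1 + c)\<bar> \<le> N * (2 * \<tau>)"
    using N by (simp add: abs_mult)
  then show ?thesis using N by (simp add: c_def)
qed

text \<open>Up to small errors \<open>c = cos (\<theta>\<^sub>z - \<theta>\<^sub>j)\<close> obeys the logistic equation \<open>c' = 1 - c\<^sup>2\<close>,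
  whose only stable rest point is \<open>c = 1\<close>.\<close>

lemma outsider_step:
  fixes \<theta> :: "nat \<Rightarrow> real ^ 'n"
  assumes orb: "slow_orbit \<mu> \<eta> \<omega> \<theta>" and cl: "clustered_on (- {z}) (\<tau>\<^sup>2 / 2) (\<theta> n)"
    and \<tau>: "0 \<le> \<tau>" "\<tau> \<le> 1" "4 * \<tau> + 10 * \<mu> \<le> 1/16" and j: "j \<noteq> z"
    and c: "- 1/2 \<le> cos (\<theta> n $ z - \<theta> n $ j)"
  shows "min (cos (\<theta> n $ z - \<theta> n $ j) + \<eta> / 8) (3/4) \<le> cos (\<theta> (Suc n) $ z - \<theta> (Suc n) $ j)"
proof -
  note o = slow_orbitD[OF orb]
  define x where "x = cos (\<theta> n $ z - \<theta> n $ j)"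
  define C where "C = mean_cos (\<theta> n) z + mean_cos (\<theta> n) j"
  have x: "- 1/2 \<le> x" "x \<le> 1" using c by (auto simp: x_def)
  have "\<bar>C - (1 + x)\<bar> \<le> 2 * \<tau>"
    unfolding C_def x_def by (rule outsider_mean_cos[OF cl \<tau>(1,2) j])
  then have "(1 - x) * ((1 + x) - 2 * \<tau>) \<le> (1 - x) * C"
    using x by (intro mult_left_mono) auto
  moreover have "(1 - x) * \<tau> \<le> 2 * \<tau>" using x \<tau> by (intro mult_right_mono) auto
  ultimately have "1 - x\<^sup>2 - 4 * \<tau> \<le> (1 - x) * C" by (simp add: algebra_simps power2_eq_square)
  then have "\<eta> * (1 - x\<^sup>2 - 4 * \<tau>) \<le> \<eta> * ((1 - x) * C)" using o(1) by (intro mult_left_mono) auto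
  moreover have "\<bar>cos (\<theta> (Suc n) $ z - \<theta> (Suc n) $ j) - (x + \<eta> * ((1 - x) * C))\<bar> \<le> 10 * \<mu> * \<eta>"
    unfolding x_def C_def by (rule slow_orbit_cos_step[OF orb])
  moreover have "\<eta> * (4 * \<tau> + 10 * \<mu>) \<le> \<eta> * (1/16)" using \<tau> o(1) by (intro mult_left_mono) auto
  ultimately have step: "x + \<eta> * (1 - x\<^sup>2) - \<eta> / 16 \<le> cos (\<theta> (Suc n) $ z - \<theta> (Suc n) $ j)"
    by (simp add: algebra_simps abs_le_iff)
  show ?thesis
  proof (cases "x \<le> 7/8")
    case True
    then have "x\<^sup>2 \<le> (7/8)\<^sup>2" using x by (intro abs_le_square_iff[THEN iffD1]) auto
    then have "\<eta> * (3/16) \<le> \<eta> * (1 - x\<^sup>2)" using o(1) by (intro mult_left_mono) (auto simp: power2_eq_square)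
    then show ?thesis using step unfolding x_def[symmetric] by linarith
  next
    case False
    have "x\<^sup>2 \<le> 1" using x by (simp add: abs_square_le_1)
    then have "0 \<le> \<eta> * (1 - x\<^sup>2)" using o(1) by simp
    then show ?thesis using step False o unfolding x_def[symmetric] by linarith
  qed
qed

lemma outsider_absorbed:
  fixes \<theta> :: "nat \<Rightarrow> real ^ 'n"
  assumes orb: "slow_orbit \<mu> \<eta> \<omega> \<theta>" and cl: "\<And>n. clustered_on (- {z}) (\<tau>\<^sup>2 / 2) (\<theta> n)"
    and \<tau>: "0 \<le> \<tau>" "\<tau> \<le> 1/2" "4 * \<tau> + 10 * \<mu> \<le> 1/16"
    and c: "\<And>j. j \<noteq> z \<Longrightarrow> - 1/2 \<le> cos (\<theta> 0 $ z - \<theta> 0 $ j)"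
  shows "\<exists>n. clustered_on UNIV (1/4) (\<theta> n)"
proof -
  note o = slow_orbitD[OF orb]
  have grow: "min (real n * (\<eta> / 8) - 1/2) (3/4) \<le> cos (\<theta> n $ z - \<theta> n $ j)" if "j \<noteq> z" for n j
  proof (induction n)
    case (Suc n)
    have "0 \<le> real n * (\<eta> / 8)" using o(1) by simp
    then have "- 1/2 \<le> cos (\<theta> n $ z - \<theta> n $ j)" using Suc by linarith
    moreover have "real (Suc n) * (\<eta> / 8) = real n * (\<eta> / 8) + \<eta> / 8" by (simp add: algebra_simps)
    moreover have "0 < \<eta> / 8" using o by simp
    ultimately show ?case
      using Suc outsider_step[OF orb cl[of n] \<tau>(1) _ \<tau>(3) that] \<tau>(2) by linarith
  qed (use c[OF that] in simp)
  obtain n where n: "2 < real n * (\<eta> / 8)"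
    using ex_less_of_nat_mult[of "\<eta> / 8" 2] o(1) by auto
  have out: "1 - 1/4 \<le> cos (\<theta> n $ z - \<theta> n $ j)" for j
    using grow[of j n] n by (cases "j = z") auto
  have "1 - 1/4 \<le> cos (\<theta> n $ i - \<theta> n $ j)" for i j
  proof -
    consider "i = z" | "j = z" | "i \<noteq> z" "j \<noteq> z" by blast
    then show ?thesis
    proof cases
      case 2
      then show ?thesis using out[of i] cos_minus[of "\<theta> n $ i - \<theta> n $ j"] by simp
    next
      case 3
      then have "1 - \<tau>\<^sup>2 / 2 \<le> cos (\<theta> n $ i - \<theta> n $ j)" using cl[of n] by (simp add: clustered_on_def)
      moreover have "\<tau>\<^sup>2 \<le> (1/2)\<^sup>2" using \<tau> by (intro power_mono) auto
      ultimately show ?thesis by (simp add: power2_eq_square)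
    qed (use out[of j] in simp)
  qed
  then show ?thesis by (auto simp: clustered_on_def)
qed

section \<open>Exponential decay of the velocities\<close>

text \<open>The mean value theorem in a form that does not single out \<open>w = 0\<close>.\<close>

lemma sin_increment:
  fixes x w :: real
  obtains a where "sin (x + w) - sin x = a * w" "\<bar>a - cos x\<bar> \<le> \<bar>w\<bar>" "\<bar>a\<bar> \<le> 1"
proof (cases "w = 0")
  case True
  then show ?thesis using that[of "cos x"] by simp
next
  case False
  define a where "a = (sin (x + w) - sin x) / w"
  have "\<exists>t. \<bar>t\<bar> \<le> \<bar>w\<bar> \<and> a = cos (x + t)"
  proof (cases "w > 0")
    case True
    then obtain t where "t > x" "t < x + w" "sin (x + w) - sin x = (x + w - x) * cos t"
      using MVT2[of x "x + w" sin cos] by (auto intro: DERIV_sin)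
    then show ?thesis using True by (intro exI[of _ "t - x"]) (auto simp: a_def)
  next
    case neg: False
    then obtain t where "t > x + w" "t < x" "sin x - sin (x + w) = (x - (x + w)) * cos t"
      using MVT2[of "x + w" x sin cos] False by (auto intro: DERIV_sin)
    then show ?thesis using neg False by (intro exI[of _ "t - x"]) (auto simp: a_def field_simps)
  qed
  then obtain t where t: "\<bar>t\<bar> \<le> \<bar>w\<bar>" "a = cos (x + t)" by blast
  show ?thesis
  proof (rule that[of a])
    show "sin (x + w) - sin x = a * w" using False by (simp add: a_def)
    show "\<bar>a - cos x\<bar> \<le> \<bar>w\<bar>" using abs_cos_diff_le[of "x + t" x] t by simp
    show "\<bar>a\<bar> \<le> 1" using t by simp
  qed
qed

definition velocity :: "(nat \<Rightarrow> real ^ 'n) \<Rightarrow> nat \<Rightarrow> real ^ 'n" where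
  "velocity \<theta> n = \<theta> (Suc n) - \<theta> n"

text \<open>The frequencies cancel when consecutive steps are subtracted: the velocities follow a linear
  consensus iteration whose coupling coefficients are close to the cosines of the phase
  differences.\<close>

lemma velocity_recursion:
  fixes \<theta> :: "nat \<Rightarrow> real ^ 'n"
  assumes orb: "slow_orbit \<mu> \<eta> \<omega> \<theta>"
  obtains a where
    "\<And>i. velocity \<theta> (Suc n) $ i = velocity \<theta> n $ i
       + \<eta> / real CARD('n) * (\<Sum>j\<in>UNIV. a i j * (velocity \<theta> n $ j - velocity \<theta> n $ i))"
    "\<And>i j. \<bar>a i j - cos (\<theta> n $ j - \<theta> n $ i)\<bar> \<le> 4 * \<eta>" "\<And>i j. \<bar>a i j\<bar> \<le> 1"
proof -
  note o = slow_orbitD[OF orb]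
  let ?v = "velocity \<theta> n"
  define P where "P i j a \<longleftrightarrow> sin (\<theta> (Suc n) $ j - \<theta> (Suc n) $ i) - sin (\<theta> n $ j - \<theta> n $ i) = a * (?v $ j - ?v $ i) \<and>
      \<bar>a - cos (\<theta> n $ j - \<theta> n $ i)\<bar> \<le> 4 * \<eta> \<and> \<bar>a\<bar> \<le> 1" for i j a
  have ex: "\<exists>a. P i j a" for i j
  proof -
    define w where "w = ?v $ j - ?v $ i"
    have w: "\<theta> (Suc n) $ j - \<theta> (Suc n) $ i = (\<theta> n $ j - \<theta> n $ i) + w"
      by (simp add: w_def velocity_def)
    have "\<bar>w\<bar> \<le> 4 * \<eta>"
      using slow_orbit_step_le[OF orb, of n i] slow_orbit_step_le[OF orb, of n j]
      by (simp add: w_def velocity_def)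
    then show ?thesis unfolding P_def w w_def[symmetric] by (metis sin_increment order_trans)
  qed
  define a where "a i j = (SOME a. P i j a)" for i j
  have "P i j (a i j)" for i j
    unfolding a_def by (rule someI_ex[OF ex])
  then have a: "\<And>i j. sin (\<theta> (Suc n) $ j - \<theta> (Suc n) $ i) - sin (\<theta> n $ j - \<theta> n $ i)
      = a i j * (?v $ j - ?v $ i)"
    "\<And>i j. \<bar>a i j - cos (\<theta> n $ j - \<theta> n $ i)\<bar> \<le> 4 * \<eta>" "\<And>i j. \<bar>a i j\<bar> \<le> 1"
    by (simp_all add: P_def)
  have "velocity \<theta> (Suc n) $ i = ?v $ i + \<eta> / real CARD('n) * (\<Sum>j\<in>UNIV. a i j * (?v $ j - ?v $ i))" for i
  proof -
    have "velocity \<theta> (Suc n) $ i - ?v $ i = \<eta> * (mean_sin (\<theta> (Suc n)) i - mean_sin (\<theta> n) i)"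
      by (simp add: velocity_def o(5) algebra_simps)
    also have "\<dots> = \<eta> * ((\<Sum>j\<in>UNIV. a i j * (?v $ j - ?v $ i)) / real CARD('n))"
      unfolding mean_sin_def diff_divide_distrib[symmetric] sum_subtractf[symmetric] a(1) ..
    finally show ?thesis by simp
  qed
  with a(2,3) show ?thesis using that by blast
qed

lemma sum_velocity_eq_0:
  assumes "slow_orbit \<mu> \<eta> \<omega> \<theta>" and "(\<Sum>i\<in>UNIV. \<omega> $ i) = 0"
  shows "(\<Sum>i\<in>UNIV. velocity \<theta> n $ i) = 0"
proof -
  note o = slow_orbitD[OF assms(1)]
  have "(\<Sum>i\<in>UNIV. velocity \<theta> n $ i) = \<eta> * ((\<Sum>i\<in>UNIV. \<omega> $ i) + (\<Sum>i\<in>UNIV. mean_sin (\<theta> n) i))"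
    by (simp add: velocity_def o(5) sum.distrib sum_distrib_left distrib_left)
  then show ?thesis by (simp add: assms(2) sum_mean_sin)
qed

definition spread :: "'n set \<Rightarrow> real ^ 'n \<Rightarrow> real" where
  "spread S v = Max ((\<lambda>(i, j). \<bar>v $ i - v $ j\<bar>) ` (S \<times> S))"

lemma spread_ge: "i \<in> S \<Longrightarrow> j \<in> S \<Longrightarrow> \<bar>v $ i - v $ j\<bar> \<le> spread S v"
  unfolding spread_def by (rule Max_ge) auto

lemma spread_le:
  assumes "S \<noteq> {}" "\<And>i j. i \<in> S \<Longrightarrow> j \<in> S \<Longrightarrow> \<bar>v $ i - v $ j\<bar> \<le> b"
  shows "spread S v \<le> b"
  unfolding spread_def using assms by (subst Max_le_iff) auto

lemma spread_nonneg: "S \<noteq> {} \<Longrightarrow> 0 \<le> spread S v"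
  using spread_ge[of _ S _ v] by fastforce

lemma component_le_spread:
  assumes "i \<in> S" "sum (($) v) S \<le> 0"
  shows "v $ i \<le> spread S v"
proof -
  have "real (card S) * (v $ i) = sum (($) v) S + (\<Sum>j\<in>S. v $ i - v $ j)"
    by (simp add: sum_subtractf)
  also have "\<dots> \<le> 0 + (\<Sum>j\<in>S. spread S v)"
    using assms(2) by (intro add_mono sum_mono) (auto intro: order_trans[OF abs_ge_self spread_ge] assms(1))
  finally have "real (card S) * (v $ i) \<le> real (card S) * spread S v" by simp
  moreover have "0 < card S" using assms(1) by (auto simp: card_gt_0_iff)
  ultimately show ?thesis by simp
qed

lemma abs_component_le_spread:
  assumes "i \<in> S"
  shows "\<bar>v $ i\<bar> \<le> \<bar>sum (($) v) S\<bar> + spread S v"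
proof -
  have "real (card S) * (v $ i) = sum (($) v) S + (\<Sum>j\<in>S. v $ i - v $ j)"
    by (simp add: sum_subtractf)
  also have "\<bar>\<dots>\<bar> \<le> \<bar>sum (($) v) S\<bar> + (\<Sum>j\<in>S. spread S v)"
    by (intro order_trans[OF abs_triangle_ineq] add_left_mono order_trans[OF sum_abs] sum_mono
        spread_ge assms)
  also have "\<dots> \<le> real (card S) * \<bar>sum (($) v) S\<bar> + (\<Sum>j\<in>S. spread S v)"
  proof -
    have "1 \<le> card S" using assms by (auto simp: Suc_le_eq card_gt_0_iff)
    then have "1 * \<bar>sum (($) v) S\<bar> \<le> real (card S) * \<bar>sum (($) v) S\<bar>" by (intro mult_right_mono) auto
    then show ?thesis by simp
  qed
  finally have "real (card S) * \<bar>v $ i\<bar> \<le> real (card S) * (\<bar>sum (($) v) S\<bar> + spread S v)"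
    by (simp add: abs_mult distrib_left)
  moreover have "0 < card S" using assms(1) by (auto simp: card_gt_0_iff)
  ultimately show ?thesis by simp
qed

text \<open>If all coefficients were 1, the sum would be exactly \<open>- card S * (v $ i - v $ k)\<close>.\<close>

lemma cluster_coupling_contracts:
  fixes a :: "'n::finite \<Rightarrow> 'n \<Rightarrow> real" and v :: "real ^ 'n"
  assumes i: "i \<in> S" and k: "k \<in> S" and "0 \<le> \<sigma>"
    and a: "\<And>i j. i \<in> S \<Longrightarrow> j \<in> S \<Longrightarrow> \<bar>a i j - 1\<bar> \<le> \<sigma>"
  shows "\<bar>(\<Sum>j\<in>S. a i j * (v $ j - v $ i) - a k j * (v $ j - v $ k))
           + real (card S) * (v $ i - v $ k)\<bar> \<le> real (card S) * (2 * \<sigma> * spread S v)"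
proof -
  have "\<bar>(\<Sum>j\<in>S. a i j * (v $ j - v $ i) - a k j * (v $ j - v $ k))
      - real (card S) * (- (v $ i - v $ k))\<bar> \<le> real (card S) * (2 * \<sigma> * spread S v)"
  proof (rule abs_sum_minus_const_le)
    fix j assume j: "j \<in> S"
    have *: "\<bar>(a l j - 1) * (v $ j - v $ l)\<bar> \<le> \<sigma> * spread S v" if "l \<in> S" for l
      unfolding abs_mult using a[OF that j] spread_ge[OF j that] assms(3) by (intro mult_mono) auto
    have "a i j * (v $ j - v $ i) - a k j * (v $ j - v $ k) - - (v $ i - v $ k)
        = (a i j - 1) * (v $ j - v $ i) - (a k j - 1) * (v $ j - v $ k)" by (simp add: algebra_simps)
    then show "\<bar>a i j * (v $ j - v $ i) - a k j * (v $ j - v $ k) - - (v $ i - v $ k)\<bar> \<le> 2 * \<sigma> * spread S v"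
      using *[OF i] *[OF k] by linarith
  qed
  moreover have "real (card S) * (- (v $ i - v $ k)) = - (real (card S) * (v $ i - v $ k))"
    by (simp only: mult_minus_right)
  ultimately show ?thesis unfolding diff_minus_eq_add by simp
qed

lemma synchronized_velocity_contracts:
  fixes \<theta> :: "nat \<Rightarrow> real ^ 'n"
  assumes orb: "slow_orbit \<mu> \<eta> \<omega> \<theta>" and \<mu>: "\<mu> \<le> 1/32" and cl: "clustered_on UNIV (1/4) (\<theta> n)"
  shows "spread UNIV (velocity \<theta> (Suc n)) \<le> (1 - \<eta> / 4) * spread UNIV (velocity \<theta> n)"
proof (rule spread_le)
  note o = slow_orbitD[OF orb]
  define N where "N = real CARD('n)"
  have N: "N > 0" by (simp add: N_def)
  fix i k :: 'n
  define v where "v = velocity \<theta> n"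
  define y where "y = spread UNIV v"
  obtain a where a: "\<And>i. velocity \<theta> (Suc n) $ i = v $ i + \<eta> / N * (\<Sum>j\<in>UNIV. a i j * (v $ j - v $ i))"
    "\<And>i j. \<bar>a i j - cos (\<theta> n $ j - \<theta> n $ i)\<bar> \<le> 4 * \<eta>" "\<And>i j. \<bar>a i j\<bar> \<le> 1"
    using velocity_recursion[OF orb, of n] unfolding v_def N_def by blast
  have "\<bar>a i j - 1\<bar> \<le> 3/8" for i j
  proof -
    have "1 - 1/4 \<le> cos (\<theta> n $ j - \<theta> n $ i)" using cl by (simp add: clustered_on_def)
    then show ?thesis using a(2)[of i j] a(3)[of i j] o(2) \<mu> by linarith
  qed
  then have "\<bar>(\<Sum>j\<in>UNIV. a i j * (v $ j - v $ i) - a k j * (v $ j - v $ k)) + N * (v $ i - v $ k)\<bar>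
      \<le> N * (2 * (3/8) * y)"
    unfolding N_def y_def by (intro cluster_coupling_contracts) auto
  then have "\<eta> / N * \<bar>(\<Sum>j\<in>UNIV. a i j * (v $ j - v $ i) - a k j * (v $ j - v $ k)) + N * (v $ i - v $ k)\<bar>
      \<le> \<eta> / N * (N * (2 * (3/8) * y))" using o(1) N by (intro mult_left_mono) auto
  then have "\<bar>\<eta> / N * ((\<Sum>j\<in>UNIV. a i j * (v $ j - v $ i) - a k j * (v $ j - v $ k)) + N * (v $ i - v $ k))\<bar>
      \<le> \<eta> * (3/4 * y)" using o(1) N by (simp add: abs_mult)
  moreover have "\<bar>(1 - \<eta>) * (v $ i - v $ k)\<bar> \<le> (1 - \<eta>) * y"
    using spread_ge[of i UNIV k v] o unfolding abs_mult y_def by (intro mult_mono) auto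
  moreover have "velocity \<theta> (Suc n) $ i - velocity \<theta> (Suc n) $ k = (1 - \<eta>) * (v $ i - v $ k)
     + \<eta> / N * ((\<Sum>j\<in>UNIV. a i j * (v $ j - v $ i) - a k j * (v $ j - v $ k)) + N * (v $ i - v $ k))"
  proof -
    define U where "U l = (\<Sum>j\<in>UNIV. a l j * (v $ j - v $ l))" for l
    show ?thesis using N unfolding a(1) sum_subtractf U_def[symmetric] by (simp add: field_simps)
  qed
  ultimately have "\<bar>velocity \<theta> (Suc n) $ i - velocity \<theta> (Suc n) $ k\<bar> \<le> (1 - \<eta>) * y + \<eta> * (3/4 * y)"
    by (simp only:)
  also have "\<dots> = (1 - \<eta> / 4) * y" by (simp add: algebra_simps)
  finally show "\<bar>velocity \<theta> (Suc n) $ i - velocity \<theta> (Suc n) $ k\<bar> \<le> (1 - \<eta> / 4) * spread UNIV (velocity \<theta> n)"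
    unfolding v_def[symmetric] y_def[symmetric] .
qed simp

text \<open>An antipodal outsider is coupled with negative coefficients, hence repelled. Since the velocities
  sum to zero, the cluster moves against the outsider on average, so it is repelled at a rate
  proportional to its own velocity, up to the spread of the velocities in the cluster.\<close>

lemma outsider_velocity_grows:
  fixes \<theta> :: "nat \<Rightarrow> real ^ 'n"
  assumes orb: "slow_orbit \<mu> \<eta> \<omega> \<theta>" and \<mu>: "\<mu> \<le> 1/32" and "(\<Sum>i\<in>UNIV. \<omega> $ i) = 0" and "CARD('n) \<ge> 3"
    and anti: "\<And>j. j \<noteq> z \<Longrightarrow> cos (\<theta> n $ z - \<theta> n $ j) \<le> - 3/8"
  shows "(1 + \<eta> / 6) * \<bar>velocity \<theta> n $ z\<bar> - \<eta> * spread (- {z}) (velocity \<theta> n) \<le> \<bar>velocity \<theta> (Suc n) $ z\<bar>"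
proof -
  note o = slow_orbitD[OF orb]
  define N where "N = real CARD('n)"
  have N: "N \<ge> 3" using assms(4) by (simp add: N_def)
  define v where "v = velocity \<theta> n"
  define y where "y = spread (- {z}) v"
  define S where "S = - {z}"
  have "S \<noteq> {}" using card_Compl_point[of z] N by (auto simp: S_def N_def)
  then have y: "0 \<le> y" unfolding y_def S_def[symmetric] by (rule spread_nonneg)
  obtain a where a: "\<And>i. velocity \<theta> (Suc n) $ i = v $ i + \<eta> / N * (\<Sum>j\<in>UNIV. a i j * (v $ j - v $ i))"
    "\<And>i j. \<bar>a i j - cos (\<theta> n $ j - \<theta> n $ i)\<bar> \<le> 4 * \<eta>" "\<And>i j. \<bar>a i j\<bar> \<le> 1"
    using velocity_recursion[OF orb, of n] unfolding v_def N_def by blast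
  have sum0: "v $ z + (\<Sum>j\<in>S. v $ j) = 0"
    using sum_velocity_eq_0[OF orb assms(3), of n] unfolding sum_split_point[of _ z] v_def S_def .
  have a4: "a z j \<le> - 1/4" if "j \<in> S" for j
  proof -
    have "cos (\<theta> n $ j - \<theta> n $ z) \<le> - 3/8"
      using anti[of j] that cos_minus[of "\<theta> n $ z - \<theta> n $ j"] by (simp add: S_def)
    then show ?thesis using a(2)[of z j] o(2) \<mu> by linarith
  qed
  \<comment> \<open>the sign of the velocity of \<open>z\<close> reduces both signs to one computation\<close>
  define e where "e = (if v $ z < 0 then - 1 else 1 :: real)"
  have e: "\<bar>v $ z\<bar> = e * (v $ z)" "\<bar>e\<bar> = 1" by (auto simp: e_def)
  have dom: "e * v $ j \<le> y" if "j \<in> S" for j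
  proof (cases "v $ z < 0")
    case True
    have neg: "spread S (- v) = spread S v" by (simp add: spread_def abs_minus_commute)
    have "(- v) $ j \<le> spread S (- v)"
      by (rule component_le_spread[OF that]) (use True sum0 in \<open>simp add: sum_negf\<close>)
    then show ?thesis using True neg unfolding y_def S_def[symmetric] by (simp add: e_def)
  next
    case False
    have "v $ j \<le> spread S v"
      by (rule component_le_spread[OF that]) (use False sum0 in simp)
    then show ?thesis using False unfolding y_def S_def[symmetric] by (simp add: e_def)
  qed
  have "(N - 1) * (\<bar>v $ z\<bar> / 4 - y) = (\<Sum>j\<in>S. \<bar>v $ z\<bar> / 4 - y)"
    unfolding S_def by (simp add: card_Compl_point N_def)
  also have "\<dots> \<le> (\<Sum>j\<in>S. a z j * (e * v $ j - \<bar>v $ z\<bar>))"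
  proof (intro sum_mono)
    fix j assume j: "j \<in> S"
    have "(- a z j) * (\<bar>v $ z\<bar> - y) \<le> (- a z j) * (\<bar>v $ z\<bar> - e * v $ j)"
      using dom[OF j] a4[OF j] by (intro mult_left_mono) auto
    moreover have "1/4 * \<bar>v $ z\<bar> \<le> (- a z j) * \<bar>v $ z\<bar>" using a4[OF j] by (intro mult_right_mono) auto
    moreover have "(- a z j) * y \<le> 1 * y" using a(3)[of z j] y by (intro mult_right_mono) auto
    ultimately show "\<bar>v $ z\<bar> / 4 - y \<le> a z j * (e * v $ j - \<bar>v $ z\<bar>)" by (simp add: algebra_simps)
  qed
  also have "\<dots> = e * (\<Sum>j\<in>UNIV. a z j * (v $ j - v $ z))"
    unfolding sum_split_point[of _ z] S_def[symmetric] e(1) by (simp add: sum_distrib_left algebra_simps)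
  finally have "\<eta> / N * ((N - 1) * (\<bar>v $ z\<bar> / 4 - y)) \<le> \<eta> / N * (e * (\<Sum>j\<in>UNIV. a z j * (v $ j - v $ z)))"
    using o(1) N by (intro mult_left_mono) auto
  moreover have "e * velocity \<theta> (Suc n) $ z = \<bar>v $ z\<bar> + \<eta> / N * (e * (\<Sum>j\<in>UNIV. a z j * (v $ j - v $ z)))"
    unfolding a(1) e(1) by (simp add: algebra_simps)
  moreover have "e * velocity \<theta> (Suc n) $ z \<le> \<bar>velocity \<theta> (Suc n) $ z\<bar>" by (auto simp: e_def)
  moreover have "\<eta> * (\<bar>v $ z\<bar> / 6 - y) \<le> \<eta> / N * ((N - 1) * (\<bar>v $ z\<bar> / 4 - y))"
  proof -
    have "2/3 * (\<bar>v $ z\<bar> / 4) \<le> (1 - 1 / N) * (\<bar>v $ z\<bar> / 4)"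
      using N by (intro mult_right_mono) (auto simp: field_simps)
    moreover have "(1 - 1 / N) * y \<le> 1 * y" using N y by (intro mult_right_mono) auto
    ultimately have "\<bar>v $ z\<bar> / 6 - y \<le> (1 - 1 / N) * (\<bar>v $ z\<bar> / 4 - y)"
      unfolding right_diff_distrib[of "1 - 1 / N"] by linarith
    then have "\<eta> * (\<bar>v $ z\<bar> / 6 - y) \<le> \<eta> * ((1 - 1 / N) * (\<bar>v $ z\<bar> / 4 - y))"
      using o(1) by (intro mult_left_mono) auto
    also have "(1 - 1 / N) = (N - 1) / N" using N by (simp add: field_simps)
    finally show ?thesis by simp
  qed
  ultimately show ?thesis
    unfolding v_def[symmetric] y_def[symmetric] by (simp add: algebra_simps)
qed

text \<open>The couplings inside the cluster contract velocity differences at rate \<open>(N - 1) / N\<close>. The outsider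
  acts almost equally on all members and costs at most \<open>1 / N\<close>; what remains is at least
  \<open>1 / 3\<close>. The unequal part of its action is of size \<open>\<sigma>\<close>.\<close>

lemma cluster_velocity_contracts:
  fixes \<theta> :: "nat \<Rightarrow> real ^ 'n"
  assumes orb: "slow_orbit \<mu> \<eta> \<omega> \<theta>" and "(\<Sum>i\<in>UNIV. \<omega> $ i) = 0" and "CARD('n) \<ge> 3"
    and cl: "clustered_on (- {z}) (\<tau>\<^sup>2 / 2) (\<theta> n)" and \<tau>: "0 \<le> \<tau>" "\<tau> \<le> 1" "\<tau> + 8 * \<mu> \<le> \<sigma>"
  shows "spread (- {z}) (velocity \<theta> (Suc n))
    \<le> (1 - \<eta> / 3 + 3 * \<eta> * \<sigma>) * spread (- {z}) (velocity \<theta> n) + 2 * \<eta> * \<sigma> * \<bar>velocity \<theta> n $ z\<bar>"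
proof (rule spread_le)
  note o = slow_orbitD[OF orb]
  define N where "N = real CARD('n)"
  have N: "N \<ge> 3" using assms(3) by (simp add: N_def)
  then show "- {z} \<noteq> {}" using card_Compl_point[of z] by (auto simp: N_def)
  then have y0: "0 \<le> spread (- {z}) (velocity \<theta> n)" by (rule spread_nonneg)
  define v where "v = velocity \<theta> n"
  define S where "S = - {z}"
  define y where "y = spread S v"
  define x where "x = \<bar>v $ z\<bar>"
  have y: "0 \<le> y" using y0 by (simp add: y_def S_def v_def)
  have x: "0 \<le> x" by (simp add: x_def)
  have \<sigma>: "0 \<le> \<sigma>" using \<tau> o by linarith
  fix i k assume "i \<in> - {z}" "k \<in> - {z}"
  then have i: "i \<in> S" and k: "k \<in> S" by (simp_all add: S_def)
  obtain a where a: "\<And>i. velocity \<theta> (Suc n) $ i = v $ i + \<eta> / N * (\<Sum>j\<in>UNIV. a i j * (v $ j - v $ i))"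
    "\<And>i j. \<bar>a i j - cos (\<theta> n $ j - \<theta> n $ i)\<bar> \<le> 4 * \<eta>" "\<And>i j. \<bar>a i j\<bar> \<le> 1"
    using velocity_recursion[OF orb, of n] unfolding v_def N_def by blast
  have sum0: "v $ z + (\<Sum>j\<in>S. v $ j) = 0"
    using sum_velocity_eq_0[OF orb assms(2), of n] unfolding sum_split_point[of _ z] v_def S_def .
  have "\<tau>\<^sup>2 / 2 \<le> \<tau>" using \<tau> mult_left_mono[of \<tau> 1 \<tau>] by (simp add: power2_eq_square)
  then have "\<bar>a i j - 1\<bar> \<le> \<sigma>" if "i \<in> S" "j \<in> S" for i j
  proof -
    have "1 - \<tau>\<^sup>2 / 2 \<le> cos (\<theta> n $ j - \<theta> n $ i)" using cl that by (simp add: clustered_on_def S_def)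
    then show ?thesis using a(2)[of i j] a(3)[of i j] o(1,2) \<tau> \<open>\<tau>\<^sup>2 / 2 \<le> \<tau>\<close> by linarith
  qed
  then have "\<bar>(\<Sum>j\<in>S. a i j * (v $ j - v $ i) - a k j * (v $ j - v $ k)) + real (card S) * (v $ i - v $ k)\<bar>
      \<le> real (card S) * (2 * \<sigma> * y)"
    unfolding y_def by (intro cluster_coupling_contracts[OF i k \<sigma>]) auto
  then have T: "\<bar>(\<Sum>j\<in>S. a i j * (v $ j - v $ i) - a k j * (v $ j - v $ k)) + (N - 1) * (v $ i - v $ k)\<bar>
      \<le> (N - 1) * (2 * \<sigma> * y)" (is "\<bar>?T + _\<bar> \<le> _")
    unfolding S_def card_Compl_point N_def .
  have az: "\<bar>a i z - a k z\<bar> \<le> \<sigma>"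
    using clustered_on_cos_to_outsider[OF cl \<tau>(1), of i k z] i k a(2)[of i z] a(2)[of k z] \<tau>(3) o(2)
    unfolding S_def by linarith
  have "\<bar>v $ i\<bar> \<le> x + y"
  proof -
    have "\<bar>\<Sum>j\<in>S. v $ j\<bar> = x" using sum0 by (simp add: x_def)
    then show ?thesis using abs_component_le_spread[OF i, of v] by (simp add: y_def)
  qed
  then have "\<bar>v $ z - v $ i\<bar> \<le> 2 * x + y" unfolding x_def by linarith
  then have U: "\<bar>(a i z - a k z) * (v $ z - v $ i)\<bar> \<le> \<sigma> * (2 * x + y)"
    unfolding abs_mult using az \<sigma> by (intro mult_mono) auto
  \<comment> \<open>the contraction rate, and the error in which all deviations from uniform coupling are collected\<close>
  define b where "b = (N - 1 + a k z) / N"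
  have b: "1/3 \<le> b" "b \<le> 1" using N a(3)[of k z] by (auto simp: b_def field_simps abs_le_iff)
  define R where "R = (?T + (N - 1) * (v $ i - v $ k)) + (a i z - a k z) * (v $ z - v $ i)"
  have "velocity \<theta> (Suc n) $ i - velocity \<theta> (Suc n) $ k
      = v $ i - v $ k + \<eta> / N * (?T + (a i z * (v $ z - v $ i) - a k z * (v $ z - v $ k)))"
  proof -
    define U where "U l = (\<Sum>j\<in>S. a l j * (v $ j - v $ l))" for l
    show ?thesis
      unfolding a(1) sum_split_point[of _ z] S_def[symmetric] sum_subtractf U_def[symmetric]
      by (simp add: algebra_simps)
  qed
  also have "\<dots> = (1 - \<eta> * b) * (v $ i - v $ k) + \<eta> / N * R"
    using N by (simp add: R_def b_def field_simps)
  finally have eq: "velocity \<theta> (Suc n) $ i - velocity \<theta> (Suc n) $ k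
    = (1 - \<eta> * b) * (v $ i - v $ k) + \<eta> / N * R" .
  have "\<bar>R\<bar> \<le> (N - 1) * (2 * \<sigma> * y) + \<sigma> * (2 * x + y)"
    unfolding R_def by (rule order_trans[OF abs_triangle_ineq add_mono[OF T U]])
  also have "\<dots> \<le> N * (\<sigma> * (3 * y + 2 * x))"
  proof -
    have "0 \<le> (N - 1) * (\<sigma> * (2 * x))" "0 \<le> N * (\<sigma> * y)" "0 \<le> \<sigma> * y" using N \<sigma> x y by simp_all
    then show ?thesis by (simp add: algebra_simps)
  qed
  finally have "\<bar>R\<bar> \<le> N * (\<sigma> * (3 * y + 2 * x))" .
  then have "\<eta> / N * \<bar>R\<bar> \<le> \<eta> / N * (N * (\<sigma> * (3 * y + 2 * x)))"
    using o(1) N by (intro mult_left_mono) auto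
  then have "\<bar>\<eta> / N * R\<bar> \<le> \<eta> * (\<sigma> * (3 * y + 2 * x))"
    using o(1) N by (simp add: abs_mult)
  moreover have "\<bar>(1 - \<eta> * b) * (v $ i - v $ k)\<bar> \<le> (1 - \<eta> / 3) * y"
  proof -
    have "\<eta> * (1/3) \<le> \<eta> * b" "\<eta> * b \<le> \<eta> * 1" using b o(1) by (intro mult_left_mono; simp)+
    then have "\<bar>1 - \<eta> * b\<bar> \<le> 1 - \<eta> / 3" using o by linarith
    then show ?thesis
      unfolding abs_mult using spread_ge[OF i k, of v] by (intro mult_mono) (auto simp: y_def)
  qed
  ultimately have "\<bar>velocity \<theta> (Suc n) $ i - velocity \<theta> (Suc n) $ k\<bar>
      \<le> (1 - \<eta> / 3) * y + \<eta> * (\<sigma> * (3 * y + 2 * x))"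
    unfolding eq by linarith
  then show "\<bar>velocity \<theta> (Suc n) $ i - velocity \<theta> (Suc n) $ k\<bar>
    \<le> (1 - \<eta> / 3 + 3 * \<eta> * \<sigma>) * spread (- {z}) (velocity \<theta> n) + 2 * \<eta> * \<sigma> * \<bar>velocity \<theta> n $ z\<bar>"
    unfolding v_def[symmetric] S_def[symmetric] y_def[symmetric] x_def[symmetric] by (simp add: algebra_simps)
qed

text \<open>The dichotomy at a saddle: \<open>x\<close> is the expanding and \<open>y\<close> the contracting direction. The cone
  \<open>x > 12 * y\<close> is invariant and \<open>x\<close> grows without bound in it, so a bounded orbit never enters
  the cone. Outside, \<open>x\<close> is controlled by \<open>y\<close> and \<open>y\<close> decays.\<close>

lemma cone_dichotomy:
  fixes x y :: "nat \<Rightarrow> real"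
  assumes x0: "\<And>n. 0 \<le> x n" and y0: "\<And>n. 0 \<le> y n" and bdd: "\<And>n. x n \<le> B" and \<eta>: "0 < \<eta>" "\<eta> \<le> 1"
    and x: "\<And>n. (1 + \<eta> / 6) * x n - \<eta> * y n \<le> x (Suc n)"
    and y: "\<And>n. y (Suc n) \<le> (1 - \<eta> / 3 + 3 * \<eta> * (1/200)) * y n + 2 * \<eta> * (1/200) * x n"
  shows "x n \<le> 12 * y n \<and> y n \<le> (1 - \<eta> / 12) ^ n * y 0"
proof -
  have cone: "x n \<le> 12 * y n" for n
  proof (rule ccontr)
    assume "\<not> x n \<le> 12 * y n"
    then have start: "12 * y n < x n" by simp
    then have pos: "0 < x n" using y0[of n] by linarith
    have "12 * y (n + k) < x (n + k) \<and> x n + real k * (\<eta> / 12 * x n) \<le> x (n + k)" for k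
    proof (induction k)
      case (Suc k)
      define X Y where "X = x (n + k)" and "Y = y (n + k)"
      have XY: "12 * Y < X" and grow: "x n + real k * (\<eta> / 12 * x n) \<le> X"
        using Suc by (simp_all add: X_def Y_def)
      have "0 \<le> real k * (\<eta> / 12 * x n)" using \<eta> pos by simp
      then have "x n \<le> X" using grow by linarith
      then have "\<eta> * x n \<le> \<eta> * X" using \<eta> by (intro mult_left_mono) auto
      have "\<eta> * (12 * Y) \<le> \<eta> * X" using XY \<eta> by (intro mult_left_mono) auto
      moreover have "X + \<eta> * X / 6 - \<eta> * Y \<le> x (n + Suc k)"
        using x[of "n + k"] by (simp add: X_def Y_def algebra_simps)
      ultimately have X': "X + \<eta> * X / 12 \<le> x (n + Suc k)" by linarith
      have "(1 - \<eta> * (3/10)) * (12 * Y) \<le> (1 - \<eta> * (3/10)) * X"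
        using XY \<eta> by (intro mult_left_mono) auto
      moreover have "y (n + Suc k) \<le> Y - \<eta> * Y / 3 + 3/200 * (\<eta> * Y) + 1/100 * (\<eta> * X)"
        using y[of "n + k"] by (simp add: X_def Y_def algebra_simps)
      moreover have "0 \<le> \<eta> * Y" using \<eta> y0[of "n + k"] by (simp add: Y_def)
      moreover have "0 < \<eta> * X" using \<eta> pos \<open>x n \<le> X\<close> by simp
      ultimately have "12 * y (n + Suc k) < X" by (simp add: algebra_simps)
      moreover have "real (Suc k) * (\<eta> / 12 * x n) = real k * (\<eta> / 12 * x n) + \<eta> * x n / 12"
        by (simp add: algebra_simps)
      ultimately show ?case
        using X' grow \<open>0 < \<eta> * X\<close> \<open>\<eta> * x n \<le> \<eta> * X\<close> by linarith
    qed (use start in simp)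
    moreover obtain k where "B < real k * (\<eta> / 12 * x n)"
      using ex_less_of_nat_mult[of "\<eta> / 12 * x n" B] \<eta> pos by auto
    ultimately show False using bdd[of "n + k"] pos by (smt (verit))
  qed
  have "y n \<le> (1 - \<eta> / 12) ^ n * y 0"
  proof (induction n)
    case (Suc n)
    have "2 * \<eta> * (1/200) * x n \<le> 2 * \<eta> * (1/200) * (12 * y n)"
      using cone[of n] \<eta> by (intro mult_left_mono) auto
    then have "y (Suc n) \<le> (1 - \<eta> / 12) * y n - \<eta> * y n * (1/4 - 3/200 - 24/200)"
      using y[of n] by (simp add: algebra_simps)
    moreover have "0 \<le> \<eta> * y n * (1/4 - 3/200 - 24/200)" using \<eta> y0[of n] by simp
    ultimately have "y (Suc n) \<le> (1 - \<eta> / 12) * y n" by linarith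
    also have "\<dots> \<le> (1 - \<eta> / 12) * ((1 - \<eta> / 12) ^ n * y 0)"
      using Suc \<eta> by (intro mult_left_mono) auto
    finally show ?case by simp
  qed simp
  with cone show ?thesis by blast
qed

text \<open>An orbit whose outsider remains antipodal for all times approaches a saddle. It must do so along the
  stable directions, because the steps, and with them the velocities, are bounded.\<close>

lemma outsider_velocity_decays:
  fixes \<theta> :: "nat \<Rightarrow> real ^ 'n"
  assumes orb: "slow_orbit \<mu> \<eta> \<omega> \<theta>" and om: "(\<Sum>i\<in>UNIV. \<omega> $ i) = 0" and N: "CARD('n) \<ge> 3"
    and cl: "\<And>n. clustered_on (- {z}) (\<tau>\<^sup>2 / 2) (\<theta> n)" and \<tau>: "0 \<le> \<tau>" "\<tau> + 8 * \<mu> \<le> 1/200"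
    and anti: "\<And>n. \<exists>j. j \<noteq> z \<and> cos (\<theta> n $ z - \<theta> n $ j) < - 1/2"
  shows "\<bar>velocity \<theta> n $ i\<bar> \<le> 13 * spread (- {z}) (velocity \<theta> 0) * (1 - \<eta> / 12) ^ n"
proof -
  note o = slow_orbitD[OF orb]
  have \<mu>: "\<mu> \<le> 1/32" "\<tau> \<le> 1/200" using \<tau> o by linarith+
  define x where "x n = \<bar>velocity \<theta> n $ z\<bar>" for n
  define y where "y n = spread (- {z}) (velocity \<theta> n)" for n
  have anti': "cos (\<theta> n $ z - \<theta> n $ j) \<le> - 3/8" if "j \<noteq> z" for n j
  proof -
    obtain k where k: "k \<noteq> z" "cos (\<theta> n $ z - \<theta> n $ k) < - 1/2" using anti by blast
    then show ?thesis
      using clustered_on_cos_to_outsider[OF cl[of n] \<tau>(1), of j k z] that \<mu> by simp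
  qed
  have "- {z} \<noteq> {}" using anti[of 0] by blast
  then have y0: "0 \<le> y n" for n unfolding y_def by (rule spread_nonneg)
  have *: "x n \<le> 12 * y n \<and> y n \<le> (1 - \<eta> / 12) ^ n * y 0"
  proof (rule cone_dichotomy[where B = "2 * \<eta>"])
    show "x n \<le> 2 * \<eta>" for n
      unfolding x_def velocity_def using slow_orbit_step_le[OF orb] by simp
    show "(1 + \<eta> / 6) * x n - \<eta> * y n \<le> x (Suc n)" for n
      unfolding x_def y_def by (rule outsider_velocity_grows[OF orb \<mu>(1) om N anti'])
    show "y (Suc n) \<le> (1 - \<eta> / 3 + 3 * \<eta> * (1/200)) * y n + 2 * \<eta> * (1/200) * x n" for n
      unfolding x_def y_def by (rule cluster_velocity_contracts[OF orb om N cl]) (use \<tau> \<mu> in auto)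
  qed (use y0 o in \<open>auto simp: x_def\<close>)
  have sum0: "velocity \<theta> n $ z + (\<Sum>j\<in>-{z}. velocity \<theta> n $ j) = 0"
    using sum_velocity_eq_0[OF orb om, of n] unfolding sum_split_point[of _ z] .
  have "\<bar>velocity \<theta> n $ i\<bar> \<le> 13 * y n"
  proof (cases "i = z")
    case True
    then show ?thesis using * y0[of n] by (simp add: x_def)
  next
    case False
    have "\<bar>\<Sum>j\<in>-{z}. velocity \<theta> n $ j\<bar> = x n" using sum0 by (simp add: x_def)
    then show ?thesis
      using abs_component_le_spread[of i "- {z}" "velocity \<theta> n"] False * by (simp add: y_def)
  qed
  also have "\<dots> \<le> 13 * ((1 - \<eta> / 12) ^ n * y 0)" using * by simp
  finally show ?thesis by (simp add: y_def algebra_simps)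
qed

lemma synchronized_velocity_decays:
  fixes \<theta> :: "nat \<Rightarrow> real ^ 'n"
  assumes orb: "slow_orbit \<mu> \<eta> \<omega> \<theta>" and om: "(\<Sum>i\<in>UNIV. \<omega> $ i) = 0" and "\<mu> \<le> 1/32"
    and cl: "\<And>n. clustered_on UNIV (1/4) (\<theta> n)"
  shows "\<bar>velocity \<theta> n $ i\<bar> \<le> spread UNIV (velocity \<theta> 0) * (1 - \<eta> / 4) ^ n"
proof -
  note o = slow_orbitD[OF orb]
  have "spread UNIV (velocity \<theta> n) \<le> spread UNIV (velocity \<theta> 0) * (1 - \<eta> / 4) ^ n"
  proof (induction n)
    case (Suc n)
    have "spread UNIV (velocity \<theta> (Suc n)) \<le> (1 - \<eta> / 4) * spread UNIV (velocity \<theta> n)"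
      by (rule synchronized_velocity_contracts[OF orb assms(3) cl])
    also have "\<dots> \<le> (1 - \<eta> / 4) * (spread UNIV (velocity \<theta> 0) * (1 - \<eta> / 4) ^ n)"
      using Suc o by (intro mult_left_mono) auto
    finally show ?case by (simp add: algebra_simps)
  qed simp
  moreover have "\<bar>velocity \<theta> n $ i\<bar> \<le> spread UNIV (velocity \<theta> n)"
    using abs_component_le_spread[of i UNIV "velocity \<theta> n"] sum_velocity_eq_0[OF orb om, of n] by simp
  ultimately show ?thesis by linarith
qed

section \<open>Convergence to a phase-locked state\<close>

lemma geometric_increments_convergent:
  fixes f :: "nat \<Rightarrow> real"
  assumes "0 \<le> q" "q < 1" "\<And>n. \<bar>f (Suc n) - f n\<bar> \<le> C * q ^ n"
  shows "convergent f"
proof -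
  have "summable (\<lambda>n. f (Suc n) - f n)"
    by (rule summable_comparison_test'[where g = "\<lambda>n. C * q ^ n" and N = 0])
      (use assms in \<open>auto intro!: summable_mult summable_geometric\<close>)
  then have "(\<lambda>n. (\<Sum>i<n. f (Suc i) - f i)) \<longlonglongrightarrow> (\<Sum>n. f (Suc n) - f n)"
    by (rule summable_LIMSEQ)
  then have "(\<lambda>n. f n - f 0) \<longlonglongrightarrow> (\<Sum>n. f (Suc n) - f n)"
    by (simp add: sum_lessThan_telescope)
  from tendsto_add[OF this tendsto_const[of "f 0"]] show ?thesis
    by (auto simp: convergent_def)
qed

text \<open>Geometrically decaying velocities make the orbit a Cauchy sequence; by continuity its limit is a fixed
  point of the scheme.\<close>

lemma slow_orbit_converges:
  fixes \<theta> :: "nat \<Rightarrow> real ^ 'n"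
  assumes orb: "slow_orbit \<mu> \<eta> \<omega> \<theta>" and q: "0 \<le> q" "q < 1"
    and decay: "\<And>n i. \<bar>velocity \<theta> n $ i\<bar> \<le> C * q ^ n"
  shows "\<exists>\<theta>inf. \<theta> \<longlonglongrightarrow> \<theta>inf \<and> (\<forall>i. \<omega> $ i + mean_sin \<theta>inf i = 0)"
proof -
  note o = slow_orbitD[OF orb]
  have "convergent (\<lambda>n. \<theta> n $ i)" for i
    by (rule geometric_increments_convergent[OF q, of _ C]) (use decay in \<open>simp add: velocity_def\<close>)
  then obtain L where L: "\<And>i. (\<lambda>n. \<theta> n $ i) \<longlonglongrightarrow> L i"
    unfolding convergent_def by metis
  define \<theta>inf :: "real ^ 'n" where "\<theta>inf = (\<chi> i. L i)"
  have lim: "\<theta> \<longlonglongrightarrow> \<theta>inf"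
    by (rule vec_tendstoI) (simp add: \<theta>inf_def L)
  have "\<omega> $ i + mean_sin \<theta>inf i = 0" for i
  proof -
    have "(\<lambda>n. \<theta> n $ i + \<eta> * (\<omega> $ i + mean_sin (\<theta> n) i)) \<longlonglongrightarrow> \<theta>inf $ i + \<eta> * (\<omega> $ i + mean_sin \<theta>inf i)"
      unfolding mean_sin_def by (intro tendsto_intros tendsto_vec_nth[OF lim]) simp
    moreover have "(\<lambda>n. \<theta> (Suc n) $ i) \<longlonglongrightarrow> \<theta>inf $ i"
      by (rule LIMSEQ_Suc[OF tendsto_vec_nth[OF lim]])
    ultimately have "\<theta>inf $ i + \<eta> * (\<omega> $ i + mean_sin \<theta>inf i) = \<theta>inf $ i"
      unfolding o(5) by (rule LIMSEQ_unique)
    then show ?thesis using o(1) by simp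
  qed
  with lim show ?thesis by blast
qed

text \<open>After a cluster has formed, either the outsider at some time leaves the antipodal region, and all
  oscillators end up in one cluster, or it stays there for ever. Both cases give exponentially
  decaying velocities.\<close>

lemma clustered_orbit_locks:
  fixes \<theta> :: "nat \<Rightarrow> real ^ 'n"
  assumes orb: "slow_orbit \<mu> \<eta> \<omega> \<theta>" and om: "(\<Sum>i\<in>UNIV. \<omega> $ i) = 0" and N: "CARD('n) \<ge> 3"
    and \<tau>: "0 \<le> \<tau>" "\<tau> + 8 * \<mu> \<le> 1/200" "30 * \<mu> \<le> \<tau>\<^sup>2 / 2"
    and cl0: "clustered_on (- {z}) (\<tau>\<^sup>2 / 2) (\<theta> 0)"
  shows "\<exists>\<theta>inf. \<theta> \<longlonglongrightarrow> \<theta>inf \<and> (\<forall>i. \<omega> $ i + mean_sin \<theta>inf i = 0)"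
proof -
  note o = slow_orbitD[OF orb]
  have t: "\<tau> \<le> 1/200" using \<tau> o by linarith
  have "\<tau>\<^sup>2 \<le> (1/200)\<^sup>2" using \<tau> t by (intro power_mono) auto
  then have "\<tau>\<^sup>2 / 2 \<le> 1/4" by (simp add: power2_eq_square)
  then have cl: "clustered_on (- {z}) (\<tau>\<^sup>2 / 2) (\<theta> n)" for n
    using slow_orbit_clustered_stays[OF orb N, of "- {z}"] \<tau> cl0 by simp
  show ?thesis
  proof (cases "\<exists>m. \<forall>j. j \<noteq> z \<longrightarrow> - 1/2 \<le> cos (\<theta> m $ z - \<theta> m $ j)")
    case True
    then obtain m where m: "\<And>j. j \<noteq> z \<Longrightarrow> - 1/2 \<le> cos (\<theta> m $ z - \<theta> m $ j)" by blast
    obtain p where p: "clustered_on UNIV (1/4) (\<theta> (m + p))"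
      using outsider_absorbed[OF slow_orbit_shift[OF orb, of m] cl \<tau>(1)] m \<tau> t o by auto
    define \<phi> where "\<phi> n = \<theta> (m + p + n)" for n
    have orb': "slow_orbit \<mu> \<eta> \<omega> \<phi>" unfolding \<phi>_def by (rule slow_orbit_shift[OF orb])
    have cl': "clustered_on UNIV (1/4) (\<phi> n)" for n
      by (rule slow_orbit_clustered_stays[OF orb' N]) (use \<tau> o p in \<open>auto simp: \<phi>_def\<close>)
    have "\<exists>\<theta>inf. \<phi> \<longlonglongrightarrow> \<theta>inf \<and> (\<forall>i. \<omega> $ i + mean_sin \<theta>inf i = 0)"
      by (rule slow_orbit_converges[OF orb' _ _ synchronized_velocity_decays[OF orb' om _ cl']])
        (use o \<tau> in auto)
    then show ?thesis unfolding \<phi>_def using LIMSEQ_offset[of \<theta> "m + p"] by (auto simp: add.commute)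
  next
    case False
    then have anti: "\<exists>j. j \<noteq> z \<and> cos (\<theta> n $ z - \<theta> n $ j) < - 1/2" for n
      by (meson not_le)
    show ?thesis
      by (rule slow_orbit_converges[OF orb _ _ outsider_velocity_decays[OF orb om N cl \<tau>(1,2) anti]])
        (use o in auto)
  qed
qed

lemma cos_eq_1_imp_eq:
  assumes "cos (x - y) = 1" "x \<in> {-pi..<pi}" "y \<in> {-pi..<pi}"
  shows "x = y"
proof -
  obtain n :: int where "x - y = of_int n * (2 * pi)"
    using assms(1) by (auto simp: cos_one_2pi_int)
  moreover have "\<bar>x - y\<bar> < 1 * (2 * pi)" using assms by auto
  ultimately have "\<bar>of_int n\<bar> * (2 * pi) < 1 * (2 * pi)" by (simp add: abs_mult)
  then have "\<bar>real_of_int n\<bar> < 1" by (rule mult_right_less_imp_less) simp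
  then have "n = 0" by linarith
  with \<open>x - y = of_int n * (2 * pi)\<close> show ?thesis by simp
qed

theorem theorem5p1:
  fixes \<Omega> \<theta>0 :: "real ^ 'n"
  assumes "CARD('n) \<ge> 3"
    and "1 / real CARD('n) * (\<Sum>j\<in>UNIV. \<Omega> $ j) = 0"
    and "1 / real CARD('n) * (\<Sum>j\<in>UNIV. \<theta>0 $ j) = 0"
    and "\<And>j. \<theta>0 $ j \<in> {-pi..<pi}"
    and "order_parameter \<theta>0 > 0"
    and "\<And>j k. j \<noteq> k \<Longrightarrow> \<theta>0 $ j \<noteq> \<theta>0 $ k"
  shows "\<exists>Kinf>0. \<forall>K>Kinf. \<exists>h0>0. \<forall>h. 0 < h \<and> h < h0 \<longrightarrow>
           (\<exists>\<theta>inf. phase_locked_state K \<Omega> \<theta>inf \<and>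
              (\<lambda>n. infnorm (discrete_kuramoto h K \<Omega> \<theta>0 n - \<theta>inf)) \<longlonglongrightarrow> 0)"
proof -
  \<comment> \<open>small enough for the 1/200 in \<open>clustered_orbit_locks\<close>, with room for the errors\<close>
  define \<tau> :: real where "\<tau> = 1/400"
  have "0 < \<tau>" "\<tau> \<le> 1" by (simp_all add: \<tau>_def)
  \<comment> \<open>the inserted 1 only makes the minimum well defined without a case distinction on the set of pairs\<close>
  define d where "d = Min (insert 1 ((\<lambda>(i, j). 1 - cos (\<theta>0 $ i - \<theta>0 $ j)) ` {(i, j). i \<noteq> j}))"
  have "0 < d"
    unfolding d_def
  proof (subst Min_gr_iff; safe?)
    fix i j :: 'n assume "i \<noteq> j"
    then have "cos (\<theta>0 $ i - \<theta>0 $ j) \<noteq> 1" using cos_eq_1_imp_eq assms(4,6) by blast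
    then show "0 < 1 - cos (\<theta>0 $ i - \<theta>0 $ j)"
      using cos_le_one[of "\<theta>0 $ i - \<theta>0 $ j"] by linarith
  qed auto
  have d: "d \<le> 1 - cos (\<theta>0 $ i - \<theta>0 $ j)" if "i \<noteq> j" for i j
    unfolding d_def by (rule Min_le) (use that in auto)
  define \<rho> where "\<rho> = order_parameter \<theta>0"
  have \<rho>: "0 < \<rho>" "\<rho> \<le> 1"
    using assms(5) order_parameter_square_le_1[of \<theta>0] by (auto simp: \<rho>_def abs_square_le_1)
  obtain \<nu> where \<nu>: "\<nu> > 0" "\<nu> \<le> 1/8" "\<And>\<eta> \<omega> (\<theta> :: nat \<Rightarrow> real ^ 'n). slow_orbit \<nu> \<eta> \<omega> \<theta> \<Longrightarrow>
      \<rho>\<^sup>2 \<le> (order_parameter (\<theta> 0))\<^sup>2 \<Longrightarrow> (\<forall>i j. i \<noteq> j \<longrightarrow> d \<le> 1 - cos (\<theta> 0 $ i - \<theta> 0 $ j)) \<Longrightarrow>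
      (\<exists>n z. clustered_on (- {z}) (2 * (\<tau> / 2)\<^sup>2) (\<theta> n))"
    using eventually_clustered[OF \<rho>, of "\<tau> / 2" d] \<open>0 < d\<close> \<open>0 < \<tau>\<close> \<open>\<tau> \<le> 1\<close>
    by (simp, blast)
  define \<mu> where "\<mu> = min \<nu> (\<tau>\<^sup>2 / 60)"
  have \<mu>: "0 < \<mu>" "\<mu> \<le> \<nu>" "\<tau> + 8 * \<mu> \<le> 1/200" "30 * \<mu> \<le> \<tau>\<^sup>2 / 2" "\<mu> \<le> 1/8"
    using \<nu>(1) by (auto simp: \<mu>_def \<tau>_def min_def power2_eq_square)
  have om: "(\<Sum>j\<in>UNIV. \<Omega> $ j) = 0" using assms(2) by simp
  show ?thesis
  proof (rule exI[of _ "(norm \<Omega> + 1) / \<mu>"], intro conjI allI impI)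
    show Kpos: "0 < (norm \<Omega> + 1) / \<mu>" using \<mu>(1) by (simp add: add_nonneg_pos)
    fix K assume K: "(norm \<Omega> + 1) / \<mu> < K"
    then have "0 < K" using Kpos by linarith
    show "\<exists>h0>0. \<forall>h. 0 < h \<and> h < h0 \<longrightarrow> (\<exists>\<theta>inf. phase_locked_state K \<Omega> \<theta>inf \<and>
              (\<lambda>n. infnorm (discrete_kuramoto h K \<Omega> \<theta>0 n - \<theta>inf)) \<longlonglongrightarrow> 0)"
    proof (rule exI[of _ "\<mu> / K"], intro conjI allI impI)
      show "0 < \<mu> / K" using \<mu>(1) \<open>0 < K\<close> by simp
      fix h assume h: "0 < h \<and> h < \<mu> / K"
      define \<theta> where "\<theta> = discrete_kuramoto h K \<Omega> \<theta>0"
      define \<omega> where "\<omega> = (1 / K) *\<^sub>R \<Omega>"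
      have "\<bar>\<omega> $ i\<bar> \<le> \<mu>" for i
      proof -
        have "norm \<Omega> + 1 < K * \<mu>" using K \<mu>(1) by (simp add: field_simps)
        then have "\<bar>\<Omega> $ i\<bar> \<le> K * \<mu>" using component_le_norm_cart[of \<Omega> i] by linarith
        then show ?thesis using \<open>0 < K\<close> by (simp add: \<omega>_def abs_mult field_simps)
      qed
      moreover have "\<theta> (Suc n) $ i = \<theta> n $ i + (h * K) * (\<omega> $ i + mean_sin (\<theta> n) i)" for n i
        using \<open>0 < K\<close> by (simp add: \<theta>_def \<omega>_def mean_sin_def Let_def field_simps)
      moreover have "0 < h * K" "h * K \<le> \<mu>" using h \<open>0 < K\<close> by (simp_all add: field_simps)
      ultimately have orb: "slow_orbit \<mu> (h * K) \<omega> \<theta>" using \<mu>(5) by (simp add: slow_orbit_def)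
      have om': "(\<Sum>i\<in>UNIV. \<omega> $ i) = 0" using om by (simp add: \<omega>_def flip: sum_divide_distrib)
      have \<theta>0: "\<theta> 0 = \<theta>0" by (simp add: \<theta>_def)
      have "\<exists>m z. clustered_on (- {z}) (2 * (\<tau> / 2)\<^sup>2) (\<theta> m)"
        using \<nu>(3)[OF slow_orbit_mono[OF orb \<mu>(2) \<nu>(2)]] d by (simp add: \<theta>0 \<rho>_def)
      then obtain m z where "clustered_on (- {z}) (2 * (\<tau> / 2)\<^sup>2) (\<theta> m)" by blast
      moreover have "2 * (\<tau> / 2)\<^sup>2 = \<tau>\<^sup>2 / 2" by (simp add: power2_eq_square)
      ultimately have cl: "clustered_on (- {z}) (\<tau>\<^sup>2 / 2) (\<theta> (m + 0))" by simp
      obtain \<theta>inf where lim: "(\<lambda>n. \<theta> (m + n)) \<longlonglongrightarrow> \<theta>inf" and eq: "\<And>i. \<omega> $ i + mean_sin \<theta>inf i = 0"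
        using clustered_orbit_locks[OF slow_orbit_shift[OF orb, of m] om' assms(1) _ \<mu>(3,4) cl]
        by (auto simp: \<tau>_def)
      have "\<theta> \<longlonglongrightarrow> \<theta>inf" using lim LIMSEQ_offset[of \<theta> m] by (simp add: add.commute)
      then have "(\<lambda>n. infnorm (\<theta> n - \<theta>inf)) \<longlonglongrightarrow> infnorm (\<theta>inf - \<theta>inf)"
        by (intro tendsto_infnorm tendsto_diff tendsto_const)
      moreover have "phase_locked_state K \<Omega> \<theta>inf"
        unfolding phase_locked_state_def
      proof
        fix i
        have "K * (\<omega> $ i + mean_sin \<theta>inf i) = 0" by (simp only: eq mult_zero_right)
        then show "\<Omega> $ i + K / real CARD('n) * (\<Sum>j\<in>UNIV. sin (\<theta>inf $ j - \<theta>inf $ i)) = 0"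
          using \<open>0 < K\<close> by (simp add: \<omega>_def mean_sin_def distrib_left)
      qed
      ultimately show "\<exists>\<theta>inf. phase_locked_state K \<Omega> \<theta>inf \<and>
          (\<lambda>n. infnorm (discrete_kuramoto h K \<Omega> \<theta>0 n - \<theta>inf)) \<longlonglongrightarrow> 0"
        by (auto simp: \<theta>_def infnorm_0)
    qed
  qed
qed

end
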